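(* Let $(\mathcal{T}_{\mathcal{A}},\theta)$ be an interventional staged tree with splitting level $k^*$. (1) There is a containment of ideals $I_{\mathcal{M}(\mathcal{T}_{\mathcal{A}})}\subset\ker(\Psi_{\mathcal{T}_{\mathcal{A}}})$. If $\mathbf{p}=\prod_{u\in L_{k^*}}\prod_{v\in V_u}p^{(u)}_{[v]}$, then $(I_{\mathcal{M}(\mathcal{T}_{\mathcal{A}})}:\mathbf{p}^{\infty})=\ker(\Psi_{\mathcal{T}_{\mathcal{A}}})$. (2) The ideal $\ker(\Psi_{\mathcal{T}_{\mathcal{A}}})$ is a minimal prime of $I_{\mathcal{M}(\mathcal{T}_{\mathcal{A}})}$. (3) The following subsets of the product of open probability simplices $\prod_{u\in L_{k^*}}\Delta^{\circ}_{|\mathbf{i}_{\mathcal{T}_u}|-1}$ coincide (the first two sets being intersected with this product): $$V_{\ge}(I_{\mathcal{M}(\mathcal{T}_{\mathcal{A}})}+\langle p_+-1\rangle)=V_{\ge}(\ker\Psi_{\mathcal{T}_{\mathcal{A}}}+\langle p_+-1\rangle)=\mathcal{M}_{(\mathcal{T}_{\mathcal{A}},\theta)}.$$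
   Context: **Staged trees.** $\mathcal{T}=(V,E)$ is a finite rooted tree with root $r$, edges directed away from $r$. $E(v)$ is the set of edges $v\to w$ leaving $v$ and $\mathrm{ch}(v)$ the set of children of $v$; $L_i$ is the set of vertices at distance $i$ from $r$. Given a surjective labeling $\theta$ of the edges, $\theta_v=\{\theta(e):e\in E(v)\}$. $(\mathcal{T},\theta)$ is a staged tree if $|\theta_v|=|E(v)|$ for all $v$ and any two sets $\theta_v,\theta_w$ are equal or disjoint. Vertices $v,w$ are in the same stage if $\theta_v=\theta_w$. For a vertex $u$, $\mathcal{T}_u=(V_u,E_u)$ is the subtree rooted at $u$ consisting of $u$ and its descendants, and $\mathbf{i}_{\mathcal{T}_u}$ its set of leaves. **Interventional staged trees.** Let $\theta:E\to\mathcal{A}\sqcup\mathcal{L}$ be a surjective labeling with partitioned label set such that $(\mathcal{T},\theta)$ is a staged tree. It is an interventional staged tree, denoted $\mathcal{T}_{\mathcal{A}}$, with splitting level $k^*$ ($k^*$ less than the largest level of $\mathcal{T}$) if: (0) the set of labels of edges leaving vertices of level $<k^*$ is $\mathcal{A}$ and the set of labels of edges leaving vertices of level $\ge k^*$ is $\mathcal{L}$; (i) each $\mathcal{T}_u$, $u\in L_{k^*}$, is a staged tree with the restricted labeling; (ii) the trees $\mathcal{T}_u$, $u\in L_{k^*}$, are all isomorphic (via fixed isomorphisms) to one rooted tree $\mathcal{T}_{\mathcal{L}}=(V_{\mathcal{L}},E_{\mathcal{L}})$ with root $r_{\mathcal{L}}$; (iii) the elements of $\mathcal{A}$ are labels $a_S$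 indexed by subsets $S\subset V_{\mathcal{L}}\setminus\{r_{\mathcal{L}}\}$; (iv) for $u,w\in L_{k^*}$ and edges $e_u\in E_u$, $e_w\in E_w$ identified with the same edge of $\mathcal{T}_{\mathcal{L}}$, pointing into $v\in V_{\mathcal{L}}$: if $v\notin S$ for every $a_S$ labeling an edge on the undirected path between $u$ and $w$, then $\theta(e_u)=\theta(e_w)$, and otherwise $\theta(e_u)\ne\theta(e_w)$. It is also assumed that no two distinct non-leaf vertices of level $<k^*$ are in the same stage. **Model.** $\Theta_{\mathcal{T}_{\mathcal{A}}}$ is the set of $x\in\mathbb{R}^{|\mathcal{L}|}$ with all coordinates positive and $\sum_{e\in E(v)}x_{\theta(e)}=1$ for every non-leaf vertex $v$ of level $\ge k^*$. $\Delta^\circ_n$ is the set of vectors in $\mathbb{R}^{n+1}$ with positive coordinates summing to $1$. $\mathcal{M}_{(\mathcal{T}_{\mathcal{A}},\theta)}$ is the image of $$\psi_{\mathcal{T}_{\mathcal{A}}}:\Theta_{\mathcal{T}_{\mathcal{A}}}\to\prod_{u\in L_{k^*}}\Delta^\circ_{|\mathbf{i}_{\mathcal{T}_u}|-1},\qquad x\mapsto\Big(\prod_{e\in\lambda_{u,\ell}}x_{\theta(e)}\Big)_{\ell\in\mathbf{i}_{\mathcal{T}_u},\,u\in L_{k^*}},$$ where $\lambda_{u,\ell}$ is the path from $u$ to $\ell$. **Ideals.** $\mathbb{R}[D_{\mathcal{T}_{\mathcal{A}}}]=\mathbb{R}[p^{(u)}_{\ell}:u\in L_{k^*},\ell\in\mathbf{i}_{\mathcal{T}_u}]$.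 For $v\in V_u$, $[v]$ is the set of leaves $\ell$ of $\mathcal{T}_u$ whose path from $u$ passes through $v$, $p^{(u)}_{[v]}=\sum_{\ell\in[v]}p^{(u)}_\ell$, and $p_+^{(u)}=p^{(u)}_{[u]}$. $\langle p_+-1\rangle$ is the ideal generated by $p_+^{(u)}-1$, $u\in L_{k^*}$. The ideal of model invariants $I_{\mathcal{M}(\mathcal{T}_{\mathcal{A}})}$ is generated by all $p^{(u_1)}_{[v]}p^{(u_2)}_{[w']}-p^{(u_1)}_{[v']}p^{(u_2)}_{[w]}$ with $u_1,u_2\in L_{k^*}$, $v\in V_{u_1}$, $w\in V_{u_2}$ in the same stage, $v'\in\mathrm{ch}(v)$, $w'\in\mathrm{ch}(w)$, $\theta(v\to v')=\theta(w\to w')$. The map $\Psi_{\mathcal{T}_{\mathcal{A}}}$ is $$\mathbb{R}[D_{\mathcal{T}_{\mathcal{A}}}]\to\mathbb{R}[a_u,\mathcal{L}:u\in L_{k^*}]/\mathfrak{q}_{\mathcal{T}_{\mathcal{A}}},\qquad p^{(u)}_\ell\mapsto a_u\prod_{e\in\lambda_{u,\ell}}\theta(e),$$ where the $a_u$ are indeterminates (one for each $u\in L_{k^*}$), the labels in $\mathcal{L}$ are treated as indeterminates, and $\mathfrak{q}_{\mathcal{T}_{\mathcal{A}}}$ is the ideal generated by $\sum_{e\in E(v)}\theta(e)-1$ for all non-leaf $v$ of level $\ge k^*$. For an ideal $J$, $V_{\ge}(J)$ is the set of points with nonnegative real coordinates at which all elements of $J$ vanish. *)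

theory Defs
  imports
    "HOL-Library.Poly_Mapping"
    "HOL-Algebra.Ideal"
    "HOL-Algebra.QuotRing"
    "HOL-Analysis.Analysis"
    "Graph_Theory.Digraph_Isomorphism"
begin

section \<open>Polynomial rings over the reals\<close>

type_synonym 'x rpoly = "('x \<Rightarrow>\<^sub>0 nat) \<Rightarrow>\<^sub>0 real"

definition mvar :: "'x \<Rightarrow> 'x rpoly" where
  "mvar x = Poly_Mapping.single (Poly_Mapping.single x 1) 1"

definition mconst :: "real \<Rightarrow> 'x rpoly" where
  "mconst c = Poly_Mapping.single 0 c"

text \<open>The ring \<open>\<real>[x : x \<in> X]\<close>, as a record on the polynomials all of whose variables lie in \<open>X\<close>.\<close>

definition mpoly_ring :: "'x set \<Rightarrow> 'x rpoly ring" where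
  "mpoly_ring X = \<lparr>
     carrier = {f. \<forall>m\<in>Poly_Mapping.keys f. Poly_Mapping.keys m \<subseteq> X},
     monoid.mult = (*), one = 1, ring.zero = 0, add = (+)\<rparr>"

text \<open>The value of a polynomial at \<open>g\<close>, where \<open>c\<close> embeds the coefficients: with \<open>c\<close> the identity
  this is evaluation at a real point, with \<open>c = mconst\<close> it is substitution of polynomials.\<close>

definition mpoly_eval :: "(real \<Rightarrow> 'b::comm_ring_1) \<Rightarrow> ('x \<Rightarrow> 'b) \<Rightarrow> 'x rpoly \<Rightarrow> 'b" where
  "mpoly_eval c g f =
     (\<Sum>m\<in>Poly_Mapping.keys f. c (Poly_Mapping.lookup f m) *
        (\<Prod>x\<in>Poly_Mapping.keys m. g x ^ Poly_Mapping.lookup m x))"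

definition saturation :: "('a, 'm) ring_scheme \<Rightarrow> 'a set \<Rightarrow> 'a \<Rightarrow> 'a set" where
  "saturation R I p = {f \<in> carrier R. \<exists>n::nat. (p [^]\<^bsub>R\<^esub> n) \<otimes>\<^bsub>R\<^esub> f \<in> I}"

definition minimal_prime_over :: "('a, 'm) ring_scheme \<Rightarrow> 'a set \<Rightarrow> 'a set \<Rightarrow> bool" where
  "minimal_prime_over R I P \<longleftrightarrow>
     primeideal P R \<and> I \<subseteq> P \<and> (\<forall>Q. primeideal Q R \<and> I \<subseteq> Q \<and> Q \<subseteq> P \<longrightarrow> Q = P)"

text \<open>Points with coordinates indexed by \<open>X\<close> are extensional functions on \<open>X\<close>.\<close>

definition nonneg_variety :: "'x set \<Rightarrow> 'x rpoly set \<Rightarrow> ('x \<Rightarrow> real) set" where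
  "nonneg_variety X J = {x \<in> X \<rightarrow>\<^sub>E {0..}. \<forall>f\<in>J. mpoly_eval (\<lambda>c. c) x f = 0}"

definition open_simplex :: "'i set \<Rightarrow> ('i \<Rightarrow> real) set" where
  "open_simplex I = {y \<in> I \<rightarrow>\<^sub>E {0<..}. (\<Sum>i\<in>I. y i) = 1}"


section \<open>Rooted trees and staged trees\<close>

text \<open>Edges point away from the root: every vertex is reached from it by exactly one directed walk.\<close>

locale rooted_tree = fin_digraph T for T :: "('v, 'e) pre_digraph" +
  fixes r :: 'v
  assumes root_in_verts: "r \<in> verts T"
    and unique_walk: "v \<in> verts T \<Longrightarrow> \<exists>!p. awalk r p v"

text \<open>In a rooted tree there is at most one walk from \<open>u\<close> to \<open>v\<close>; \<open>tree_path\<close> is only meaningful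
  if \<open>v\<close> is a descendant of \<open>u\<close>.\<close>

definition tree_path :: "('v, 'e) pre_digraph \<Rightarrow> 'v \<Rightarrow> 'v \<Rightarrow> 'e list" where
  "tree_path T u v = (THE p. pre_digraph.awalk T u p v)"

definition level :: "('v, 'e) pre_digraph \<Rightarrow> 'v \<Rightarrow> 'v \<Rightarrow> nat" where
  "level T r v = length (tree_path T r v)"

definition level_set :: "('v, 'e) pre_digraph \<Rightarrow> 'v \<Rightarrow> nat \<Rightarrow> 'v set" where
  "level_set T r i = {v \<in> verts T. level T r v = i}"

definition leaves :: "('v, 'e) pre_digraph \<Rightarrow> 'v set" where
  "leaves T = {v \<in> verts T. out_arcs T v = {}}"

definition subtree_at :: "('v, 'e) pre_digraph \<Rightarrow> 'v \<Rightarrow> ('v, 'e) pre_digraph" where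
  "subtree_at T u = T \<restriction> {v. u \<rightarrow>\<^sup>*\<^bsub>T\<^esub> v}"

definition on_undirected_path :: "('v, 'e) pre_digraph \<Rightarrow> 'v \<Rightarrow> 'v \<Rightarrow> 'e \<Rightarrow> bool" where
  "on_undirected_path T u w e \<longleftrightarrow> e \<in> arcs T \<and>
     (\<exists>p. pre_digraph.apath (with_proj (mk_symmetric T)) u p w \<and>
          ((tail T e, head T e) \<in> set p \<or> (head T e, tail T e) \<in> set p))"

definition stage_labels :: "('v, 'e) pre_digraph \<Rightarrow> ('e \<Rightarrow> 'l) \<Rightarrow> 'v \<Rightarrow> 'l set" where
  "stage_labels T \<theta> v = \<theta> ` out_arcs T v"

definition same_stage :: "('v, 'e) pre_digraph \<Rightarrow> ('e \<Rightarrow> 'l) \<Rightarrow> 'v \<Rightarrow> 'v \<Rightarrow> bool" where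
  "same_stage T \<theta> v w \<longleftrightarrow> stage_labels T \<theta> v = stage_labels T \<theta> w"

locale staged_tree = rooted_tree T r for T :: "('v, 'e) pre_digraph" and r :: 'v +
  fixes \<theta> :: "'e \<Rightarrow> 'l"
  assumes card_stage_labels: "v \<in> verts T \<Longrightarrow> card (stage_labels T \<theta> v) = card (out_arcs T v)"
    and stage_labels_eq_or_disjoint: "v \<in> verts T \<Longrightarrow> w \<in> verts T \<Longrightarrow>
      stage_labels T \<theta> v = stage_labels T \<theta> w \<or> stage_labels T \<theta> v \<inter> stage_labels T \<theta> w = {}"


section \<open>Interventional staged trees\<close>

text \<open>The label alphabets are \<open>A\<close> and \<open>L\<close>, and \<open>idx a\<close> is the subset \<open>S\<close> in the notation \<open>a\<^sub>S\<close> for the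
  label \<open>a \<in> A\<close>. The tree \<open>TL\<close> with root \<open>rL\<close> is the common shape of the subtrees at level \<open>k\<close>,
  and \<open>\<phi> u\<close> is the chosen isomorphism onto it.\<close>

locale interventional_staged_tree =
  staged_tree T r \<theta> + TL: rooted_tree TL rL
  for T :: "('v, 'e) pre_digraph" and r :: 'v and \<theta> :: "'e \<Rightarrow> 'l"
    and TL :: "('w, 'f) pre_digraph" and rL :: 'w +
  fixes A L :: "'l set" and k :: nat
    and idx :: "'l \<Rightarrow> 'w set"
    and \<phi> :: "'v \<Rightarrow> ('v, 'e, 'w, 'f) digraph_isomorphism"
  assumes labels_disjoint: "A \<inter> L = {}"
    and label_surj: "\<theta> ` arcs T = A \<union> L"
    and splitting_level: "k < Max (level T r ` verts T)"
    and labels_above: "\<theta> ` {e \<in> arcs T. level T r (tail T e) < k} = A"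
    and labels_below: "\<theta> ` {e \<in> arcs T. k \<le> level T r (tail T e)} = L"
    and subtree_staged: "u \<in> level_set T r k \<Longrightarrow> staged_tree (subtree_at T u) u \<theta>"
    and subtree_iso: "u \<in> level_set T r k \<Longrightarrow>
      pre_digraph.digraph_isomorphism (subtree_at T u) (\<phi> u) \<and>
      app_iso (\<phi> u) (subtree_at T u) = TL \<and> iso_verts (\<phi> u) u = rL"
    and idx_subset: "a \<in> A \<Longrightarrow> idx a \<subseteq> verts TL - {rL}"
    and identified_edges_eq:
      "u \<in> level_set T r k \<Longrightarrow> w \<in> level_set T r k \<Longrightarrow>
       e \<in> arcs (subtree_at T u) \<Longrightarrow> e' \<in> arcs (subtree_at T w) \<Longrightarrow>
       iso_arcs (\<phi> u) e = f \<Longrightarrow> iso_arcs (\<phi> w) e' = f \<Longrightarrow>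
       (\<And>d. on_undirected_path T u w d \<Longrightarrow> head TL f \<notin> idx (\<theta> d)) \<Longrightarrow>
       \<theta> e = \<theta> e'"
    and identified_edges_neq:
      "u \<in> level_set T r k \<Longrightarrow> w \<in> level_set T r k \<Longrightarrow>
       e \<in> arcs (subtree_at T u) \<Longrightarrow> e' \<in> arcs (subtree_at T w) \<Longrightarrow>
       iso_arcs (\<phi> u) e = f \<Longrightarrow> iso_arcs (\<phi> w) e' = f \<Longrightarrow>
       on_undirected_path T u w d \<Longrightarrow> head TL f \<in> idx (\<theta> d) \<Longrightarrow>
       \<theta> e \<noteq> \<theta> e'"
    and distinct_stages_above:
      "v \<in> verts T \<Longrightarrow> w \<in> verts T \<Longrightarrow> level T r v < k \<Longrightarrow> level T r w < k \<Longrightarrow>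
       out_arcs T v \<noteq> {} \<Longrightarrow> out_arcs T w \<noteq> {} \<Longrightarrow> v \<noteq> w \<Longrightarrow> \<not> same_stage T \<theta> v w"


section \<open>The interventional model\<close>

text \<open>The index set of the coordinates \<open>p\<^sub>\<ell>\<close> of the leaves \<open>\<ell>\<close> of the subtrees at \<open>u\<close>.\<close>

definition coords :: "('v, 'e) pre_digraph \<Rightarrow> 'v \<Rightarrow> nat \<Rightarrow> ('v \<times> 'v) set" where
  "coords T r k = (SIGMA u:level_set T r k. leaves (subtree_at T u))"

definition params ::
  "('v, 'e) pre_digraph \<Rightarrow> 'v \<Rightarrow> ('e \<Rightarrow> 'l) \<Rightarrow> 'l set \<Rightarrow> nat \<Rightarrow> ('l \<Rightarrow> real) set" where
  "params T r \<theta> L k = {x \<in> L \<rightarrow>\<^sub>E {0<..}.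
     \<forall>v\<in>verts T. k \<le> level T r v \<and> out_arcs T v \<noteq> {} \<longrightarrow> (\<Sum>e\<in>out_arcs T v. x (\<theta> e)) = 1}"

definition model_map ::
  "('v, 'e) pre_digraph \<Rightarrow> 'v \<Rightarrow> ('e \<Rightarrow> 'l) \<Rightarrow> nat \<Rightarrow> ('l \<Rightarrow> real) \<Rightarrow> ('v \<times> 'v \<Rightarrow> real)" where
  "model_map T r \<theta> k x = (\<lambda>(u, l)\<in>coords T r k. \<Prod>e\<leftarrow>tree_path T u l. x (\<theta> e))"

definition model ::
  "('v, 'e) pre_digraph \<Rightarrow> 'v \<Rightarrow> ('e \<Rightarrow> 'l) \<Rightarrow> 'l set \<Rightarrow> nat \<Rightarrow> ('v \<times> 'v \<Rightarrow> real) set" where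
  "model T r \<theta> L k = model_map T r \<theta> k ` params T r \<theta> L k"

text \<open>The product over \<open>u\<close> of the open simplices on the leaves of the subtree at \<open>u\<close>, uncurried.\<close>

definition simplex_product :: "('v, 'e) pre_digraph \<Rightarrow> 'v \<Rightarrow> nat \<Rightarrow> ('v \<times> 'v \<Rightarrow> real) set" where
  "simplex_product T r k = {x \<in> extensional (coords T r k).
     \<forall>u\<in>level_set T r k.
       (\<lambda>l\<in>leaves (subtree_at T u). x (u, l)) \<in> open_simplex (leaves (subtree_at T u))}"


section \<open>Ideals of the model\<close>

abbreviation data_ring :: "('v, 'e) pre_digraph \<Rightarrow> 'v \<Rightarrow> nat \<Rightarrow> ('v \<times> 'v) rpoly ring" where
  "data_ring T r k \<equiv> mpoly_ring (coords T r k)"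

text \<open>The leaves of the subtree at \<open>u\<close> whose path from \<open>u\<close> passes through \<open>v\<close>.\<close>

definition leaves_through :: "('v, 'e) pre_digraph \<Rightarrow> 'v \<Rightarrow> 'v \<Rightarrow> 'v set" where
  "leaves_through T u v = {l \<in> leaves (subtree_at T u).
     v \<in> set (pre_digraph.awalk_verts T u (tree_path T u l))}"

definition p_at :: "('v, 'e) pre_digraph \<Rightarrow> 'v \<Rightarrow> 'v \<Rightarrow> ('v \<times> 'v) rpoly" where
  "p_at T u v = (\<Sum>l\<in>leaves_through T u v. mvar (u, l))"

definition p_prod :: "('v, 'e) pre_digraph \<Rightarrow> 'v \<Rightarrow> nat \<Rightarrow> ('v \<times> 'v) rpoly" where
  "p_prod T r k = (\<Prod>u\<in>level_set T r k. \<Prod>v\<in>verts (subtree_at T u). p_at T u v)"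

definition sum_to_one_ideal :: "('v, 'e) pre_digraph \<Rightarrow> 'v \<Rightarrow> nat \<Rightarrow> ('v \<times> 'v) rpoly set" where
  "sum_to_one_ideal T r k =
     genideal (data_ring T r k) {p_at T u u - 1 | u. u \<in> level_set T r k}"

text \<open>A child \<open>v'\<close> of \<open>v\<close> is given by the edge \<open>e\<close> from \<open>v\<close> to \<open>v'\<close>, and likewise \<open>w'\<close> by \<open>d\<close>.\<close>

definition invariants_ideal ::
  "('v, 'e) pre_digraph \<Rightarrow> 'v \<Rightarrow> ('e \<Rightarrow> 'l) \<Rightarrow> nat \<Rightarrow> ('v \<times> 'v) rpoly set" where
  "invariants_ideal T r \<theta> k = genideal (data_ring T r k)
     {p_at T u1 v * p_at T u2 (head T d) - p_at T u1 (head T e) * p_at T u2 w | u1 u2 v w e d.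
        u1 \<in> level_set T r k \<and> u2 \<in> level_set T r k \<and>
        v \<in> verts (subtree_at T u1) \<and> w \<in> verts (subtree_at T u2) \<and> same_stage T \<theta> v w \<and>
        e \<in> out_arcs T v \<and> d \<in> out_arcs T w \<and> \<theta> e = \<theta> d}"

text \<open>The indeterminate attached to \<open>u\<close> is \<open>Inl u\<close>, the label \<open>l\<close> as an indeterminate is \<open>Inr l\<close>.\<close>

definition param_ring ::
  "('v, 'e) pre_digraph \<Rightarrow> 'v \<Rightarrow> 'l set \<Rightarrow> nat \<Rightarrow> ('v + 'l) rpoly ring" where
  "param_ring T r L k = mpoly_ring (Inl ` level_set T r k \<union> Inr ` L)"

definition q_ideal ::
  "('v, 'e) pre_digraph \<Rightarrow> 'v \<Rightarrow> ('e \<Rightarrow> 'l) \<Rightarrow> 'l set \<Rightarrow> nat \<Rightarrow> ('v + 'l) rpoly set" where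
  "q_ideal T r \<theta> L k = genideal (param_ring T r L k)
     {(\<Sum>e\<in>out_arcs T v. mvar (Inr (\<theta> e))) - 1 | v.
        v \<in> verts T \<and> k \<le> level T r v \<and> out_arcs T v \<noteq> {}}"

definition Psi ::
  "('v, 'e) pre_digraph \<Rightarrow> 'v \<Rightarrow> ('e \<Rightarrow> 'l) \<Rightarrow> 'l set \<Rightarrow> nat \<Rightarrow>
   ('v \<times> 'v) rpoly \<Rightarrow> ('v + 'l) rpoly set" where
  "Psi T r \<theta> L k f = q_ideal T r \<theta> L k +>\<^bsub>param_ring T r L k\<^esub>
     mpoly_eval mconst
       (\<lambda>(u, l). mvar (Inl u) * (\<Prod>e\<leftarrow>tree_path T u l. mvar (Inr (\<theta> e)))) f"

definition ker_Psi ::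
  "('v, 'e) pre_digraph \<Rightarrow> 'v \<Rightarrow> ('e \<Rightarrow> 'l) \<Rightarrow> 'l set \<Rightarrow> nat \<Rightarrow> ('v \<times> 'v) rpoly set" where
  "ker_Psi T r \<theta> L k =
     a_kernel (data_ring T r k) (param_ring T r L k Quot q_ideal T r \<theta> L k) (Psi T r \<theta> L k)"

end

theory Submission
  imports Defs "HOL-Computational_Algebra.Polynomial_Factorial"
begin

text \<open>
  Sending \<open>a\<^sub>u\<close> to \<open>p\<^sub>+\<close> and the label of an edge \<open>v \<rightarrow> w\<close> to \<open>p\<^bsub>[w]\<^esub> / p\<^bsub>[v]\<^esub>\<close> is well defined modulo the model
  invariants once all \<open>p\<^bsub>[v]\<^esub>\<close> are invertible: the invariants say exactly that these quotients depend
  only on the label, and the stage equations hold because \<open>p\<^bsub>[v]\<^esub>\<close> is the sum over the children of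
  \<open>v\<close>. Along a path the quotients telescope, so this map inverts the monomial map modulo the
  localized invariants; hence the kernel of the monomial map is contained in the saturation.
  Conversely the stage equations can be solved for one label per stage, so the target ring is a
  polynomial ring, the kernel is prime and does not contain the product of the \<open>p\<^bsub>[v]\<^esub>\<close>. A prime
  between the invariants and the kernel then avoids that product and contains the saturation.
  At positive real points the same quotients recover the parameters.
\<close>

section \<open>Evaluation as a ring homomorphism, and calculation modulo an ideal\<close>

section \<open>Polynomial evaluation\<close>

lemma poly_mapping_sum_single:
  "f = (\<Sum>m\<in>Poly_Mapping.keys f. Poly_Mapping.single m (Poly_Mapping.lookup f m))"
  by (rule poly_mapping_eqI)
    (simp add: lookup_sum lookup_single when_def in_keys_iff)

definition monom_eval :: "('x \<Rightarrow> 'b::comm_ring_1) \<Rightarrow> ('x \<Rightarrow>\<^sub>0 nat) \<Rightarrow> 'b" where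
  "monom_eval g m = (\<Prod>x\<in>Poly_Mapping.keys m. g x ^ Poly_Mapping.lookup m x)"

lemma monom_eval_add: "monom_eval g (m + n) = monom_eval g m * monom_eval g n"
proof -
  let ?A = "Poly_Mapping.keys m \<union> Poly_Mapping.keys n"
  \<comment> \<open>Over the union of the supports all three products share one index set; an added
    factor is \<open>g x ^ 0 = 1\<close>.\<close>
  have extend: "monom_eval g k = (\<Prod>x\<in>?A. g x ^ Poly_Mapping.lookup k x)"
    if "Poly_Mapping.keys k \<subseteq> ?A" for k
    unfolding monom_eval_def using that
    by (intro prod.mono_neutral_left) (auto simp: in_keys_iff)
  show ?thesis
    by (subst (1 2 3) extend)
      (use keys_add[of m n] in \<open>auto simp: lookup_add power_add prod.distrib\<close>)
qed

lemma monom_eval_zero [simp]: "monom_eval g 0 = 1"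
  by (simp add: monom_eval_def)

lemma monom_eval_single [simp]: "monom_eval g (Poly_Mapping.single x n) = g x ^ n"
  by (simp add: monom_eval_def)

lemma mconst_0 [simp]: "mconst 0 = 0"
  by (simp add: mconst_def)

lemma mconst_1 [simp]: "mconst 1 = 1"
  by (simp add: mconst_def)

lemma mconst_add: "mconst (a + b) = mconst a + mconst b"
  by (simp add: mconst_def single_add)

lemma mconst_mult: "mconst (a * b) = mconst a * mconst b"
  by (simp add: mconst_def mult_single)

text \<open>The embedding \<open>c\<close> stays abstract because three targets occur: real numbers
  for points, polynomials for substitutions, and a fraction field for localization.\<close>

locale coeff_hom =
  fixes c :: "real \<Rightarrow> 'b::comm_ring_1"
  assumes c_0: "c 0 = 0"
    and c_1: "c 1 = 1"
    and c_add: "c (a + b) = c a + c b"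
    and c_mult: "c (a * b) = c a * c b"
begin

lemma eval_conv: "mpoly_eval c g f =
    (\<Sum>m\<in>Poly_Mapping.keys f. c (Poly_Mapping.lookup f m) * monom_eval g m)"
  by (simp add: mpoly_eval_def monom_eval_def)

lemma eval_add: "mpoly_eval c g (p + q) = mpoly_eval c g p + mpoly_eval c g q"
  unfolding eval_conv by (rule setsum_keys_plus_distrib) (simp_all add: c_0 c_add algebra_simps)

lemma eval_0 [simp]: "mpoly_eval c g 0 = 0"
  by (simp add: eval_conv)

lemma eval_single: "mpoly_eval c g (Poly_Mapping.single m a) = c a * monom_eval g m"
  by (simp add: eval_conv c_0)

lemma eval_1 [simp]: "mpoly_eval c g 1 = 1"
  using eval_single[of g 0 1] by (simp add: c_1)

lemma eval_mvar [simp]: "mpoly_eval c g (mvar x) = g x"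
  by (simp add: mvar_def eval_single c_1)

lemma eval_mconst [simp]: "mpoly_eval c g (mconst a) = c a"
  by (simp add: mconst_def eval_single)

lemma eval_sum: "mpoly_eval c g (\<Sum>i\<in>A. h i) = (\<Sum>i\<in>A. mpoly_eval c g (h i))"
  by (induction A rule: infinite_finite_induct) (simp_all add: eval_add)

lemma eval_uminus: "mpoly_eval c g (- p) = - mpoly_eval c g p"
  using eval_add[of g p "- p"] by (simp add: eq_neg_iff_add_eq_0 add.commute)

lemma eval_diff: "mpoly_eval c g (p - q) = mpoly_eval c g p - mpoly_eval c g q"
  using eval_add[of g p "- q"] by (simp add: eval_uminus)

lemma eval_mult: "mpoly_eval c g (p * q) = mpoly_eval c g p * mpoly_eval c g q"
proof -
  have "p * q = (\<Sum>m\<in>Poly_Mapping.keys p. Poly_Mapping.single m (Poly_Mapping.lookup p m)) *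
      (\<Sum>m\<in>Poly_Mapping.keys q. Poly_Mapping.single m (Poly_Mapping.lookup q m))"
    by (simp only: poly_mapping_sum_single[symmetric])
  also have "\<dots> = (\<Sum>m\<in>Poly_Mapping.keys p. \<Sum>n\<in>Poly_Mapping.keys q.
      Poly_Mapping.single (m + n) (Poly_Mapping.lookup p m * Poly_Mapping.lookup q n))"
    by (simp add: sum_product mult_single)
  finally have "p * q = \<dots>" .
  then show ?thesis
    by (simp only: eval_sum eval_single monom_eval_add c_mult)
      (simp add: eval_conv sum_product mult_ac)
qed

lemma eval_power: "mpoly_eval c g (p ^ n) = mpoly_eval c g p ^ n"
  by (induction n) (simp_all add: eval_mult)

lemma eval_prod: "mpoly_eval c g (\<Prod>i\<in>A. h i) = (\<Prod>i\<in>A. mpoly_eval c g (h i))"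
  by (induction A rule: infinite_finite_induct) (simp_all add: eval_mult)

lemma eval_prod_list:
  "mpoly_eval c g (\<Prod>i\<leftarrow>xs. h i) = (\<Prod>i\<leftarrow>xs. mpoly_eval c g (h i))"
  by (induction xs) (simp_all add: eval_mult)

lemmas eval_simps = eval_add eval_diff eval_uminus eval_mult eval_power eval_sum eval_prod
  eval_prod_list

text \<open>Composites are thereby determined by the images of the variables; renumbering,
  elimination and the monomial map are all composed through this law.\<close>

lemma eval_eval:
  "mpoly_eval c g (mpoly_eval mconst h f) = mpoly_eval c (\<lambda>x. mpoly_eval c g (h x)) f"
  unfolding mpoly_eval_def[of mconst] mpoly_eval_def[of c "\<lambda>x. mpoly_eval c g (h x)"]
  by (simp add: eval_simps)

end

interpretation coeff_hom_id: coeff_hom "\<lambda>a. a"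
  by (rule coeff_hom.intro) (rule refl)+

interpretation coeff_hom_mconst: coeff_hom mconst
  by (rule coeff_hom.intro) (rule mconst_0 mconst_1 mconst_add mconst_mult)+

text \<open>With variables numbered by \<open>nat\<close> the monomials are linearly ordered, so
  leading terms multiply and \<open>nat rpoly\<close> is an integral domain with a fraction
  field.\<close>

interpretation coeff_hom_fract: coeff_hom "\<lambda>a. to_fract (mconst a :: nat rpoly)"
  by (rule coeff_hom.intro) (simp_all only: mconst_0 mconst_1 mconst_add mconst_mult
    to_fract_0 to_fract_1 to_fract_add to_fract_mult)

lemma single_conv_monom_eval:
  "Poly_Mapping.single m a = mconst a * monom_eval mvar m"
proof -
  have mvar_power: "mvar x ^ n = Poly_Mapping.single (Poly_Mapping.single x n) 1" for x :: 'a and n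
  proof (induction n)
    case (Suc n)
    have "Poly_Mapping.single x (Suc n) = Poly_Mapping.single x 1 + Poly_Mapping.single x n"
      using single_add[of x 1 n] by simp
    then show ?case
      unfolding power_Suc Suc.IH by (simp add: mvar_def mult_single)
  qed simp
  have "monom_eval mvar m = Poly_Mapping.single m 1"
  proof -
    have "(\<Prod>x\<in>A. Poly_Mapping.single (f x) (1::real)) = Poly_Mapping.single (\<Sum>x\<in>A. f x) 1"
      for A and f :: "'a \<Rightarrow> 'a \<Rightarrow>\<^sub>0 nat"
      by (induction A rule: infinite_finite_induct) (simp_all add: mult_single)
    then show ?thesis
      by (simp add: monom_eval_def mvar_power poly_mapping_sum_single[symmetric])
  qed
  then show ?thesis
    by (simp add: mconst_def mult_single)
qed

lemma mpoly_eval_mvar [simp]: "mpoly_eval mconst mvar f = f"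
  unfolding coeff_hom_mconst.eval_conv single_conv_monom_eval[symmetric]
  by (rule poly_mapping_sum_single[symmetric])

lemma mpoly_ring_varsD:
  "f \<in> carrier (mpoly_ring X) \<Longrightarrow> m \<in> Poly_Mapping.keys f \<Longrightarrow> x \<in> Poly_Mapping.keys m \<Longrightarrow> x \<in> X"
  by (auto simp: mpoly_ring_def)

lemma mpoly_eval_cong:
  assumes "f \<in> carrier (mpoly_ring X)" "\<And>x. x \<in> X \<Longrightarrow> g x = h x"
  shows "mpoly_eval c g f = mpoly_eval c h f"
proof -
  have "(\<Prod>x\<in>Poly_Mapping.keys m. g x ^ Poly_Mapping.lookup m x) =
      (\<Prod>x\<in>Poly_Mapping.keys m. h x ^ Poly_Mapping.lookup m x)"
    if "m \<in> Poly_Mapping.keys f" for m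
    using mpoly_ring_varsD[OF assms(1) that] assms(2) by (intro prod.cong) auto
  then show ?thesis
    by (simp add: mpoly_eval_def)
qed

subsection \<open>Congruences in a subring\<close>

text \<open>\<open>J\<close> is an ideal of the subring \<open>S\<close>, not of the ambient ring: in the applications the latter
  may be a fraction field.\<close>

locale subring_ideal =
  fixes S J :: "'b::comm_ring_1 set"
  assumes one_S: "1 \<in> S"
    and add_S: "x \<in> S \<Longrightarrow> y \<in> S \<Longrightarrow> x + y \<in> S"
    and uminus_S: "x \<in> S \<Longrightarrow> - x \<in> S"
    and mult_S: "x \<in> S \<Longrightarrow> y \<in> S \<Longrightarrow> x * y \<in> S"
    and zero_J: "0 \<in> J"
    and add_J: "x \<in> J \<Longrightarrow> y \<in> J \<Longrightarrow> x + y \<in> J"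
    and mult_J: "x \<in> S \<Longrightarrow> y \<in> J \<Longrightarrow> x * y \<in> J"
begin

lemma zero_S: "0 \<in> S"
  using add_S[OF one_S uminus_S[OF one_S]] by simp

lemma diff_S: "x \<in> S \<Longrightarrow> y \<in> S \<Longrightarrow> x - y \<in> S"
  using add_S[OF _ uminus_S, of x y] by simp

lemma power_S: "x \<in> S \<Longrightarrow> x ^ n \<in> S"
  by (induction n) (auto intro: one_S mult_S)

lemma prod_S: "(\<And>i. i \<in> A \<Longrightarrow> f i \<in> S) \<Longrightarrow> prod f A \<in> S"
  by (induction A rule: infinite_finite_induct) (auto intro: one_S mult_S)

lemma sum_S: "(\<And>i. i \<in> A \<Longrightarrow> f i \<in> S) \<Longrightarrow> sum f A \<in> S"
  by (induction A rule: infinite_finite_induct) (auto intro: zero_S add_S)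

lemma prod_list_S: "(\<And>i. i \<in> set xs \<Longrightarrow> f i \<in> S) \<Longrightarrow> (\<Prod>i\<leftarrow>xs. f i) \<in> S"
  by (induction xs) (auto intro: one_S mult_S)

lemma uminus_J: "x \<in> J \<Longrightarrow> - x \<in> J"
  using mult_J[OF uminus_S[OF one_S], of x] by simp

lemma diff_J: "x \<in> J \<Longrightarrow> y \<in> J \<Longrightarrow> x - y \<in> J"
  using add_J[OF _ uminus_J, of x y] by simp

lemma sum_J: "(\<And>i. i \<in> A \<Longrightarrow> f i \<in> J) \<Longrightarrow> sum f A \<in> J"
  by (induction A rule: infinite_finite_induct) (auto intro: zero_J add_J)

lemma mult_cong_J:
  assumes "a - a' \<in> J" "b - b' \<in> J" "a \<in> S" "b' \<in> S"
  shows "a * b - a' * b' \<in> J"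
proof -
  have "a * b - a' * b' = a * (b - b') + b' * (a - a')"
    by (simp add: algebra_simps)
  then show ?thesis
    using assms by (auto intro: add_J mult_J)
qed

lemma power_cong_J: "a - a' \<in> J \<Longrightarrow> a \<in> S \<Longrightarrow> a' \<in> S \<Longrightarrow> a ^ n - a' ^ n \<in> J"
  by (induction n) (auto intro: mult_cong_J power_S zero_J)

lemma prod_cong_J:
  "(\<And>i. i \<in> A \<Longrightarrow> f i - h i \<in> J \<and> f i \<in> S \<and> h i \<in> S) \<Longrightarrow> prod f A - prod h A \<in> J"
  by (induction A rule: infinite_finite_induct) (auto intro!: mult_cong_J prod_S zero_J)

lemma eval_S:
  assumes "f \<in> carrier (mpoly_ring X)" "\<And>a. c a \<in> S" "\<And>x. x \<in> X \<Longrightarrow> g x \<in> S"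
  shows "mpoly_eval c g f \<in> S"
  using assms unfolding mpoly_eval_def mpoly_ring_def
  by (auto intro!: sum_S mult_S prod_S power_S)

text \<open>Congruence modulo \<open>J\<close> passes through powers, products and sums, so two
  evaluations need only be compared on the variables in \<open>X\<close>.\<close>

lemma eval_cong_J:
  assumes "f \<in> carrier (mpoly_ring X)" "\<And>a. c a \<in> S"
    "\<And>x. x \<in> X \<Longrightarrow> g x \<in> S" "\<And>x. x \<in> X \<Longrightarrow> h x \<in> S" "\<And>x. x \<in> X \<Longrightarrow> g x - h x \<in> J"
  shows "mpoly_eval c g f - mpoly_eval c h f \<in> J"
proof -
  have "c a * monom_eval g m - c a * monom_eval h m \<in> J"
    if "m \<in> Poly_Mapping.keys f" for m a
  proof -
    have "monom_eval g m - monom_eval h m \<in> J"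
      unfolding monom_eval_def using mpoly_ring_varsD[OF assms(1) that] assms(3-)
      by (intro prod_cong_J conjI power_cong_J power_S) auto
    then show ?thesis
      using mult_J[OF assms(2)] by (simp add: right_diff_distrib[symmetric])
  qed
  then show ?thesis
    unfolding mpoly_eval_def monom_eval_def[symmetric] sum_subtractf[symmetric]
    by (intro sum_J) auto
qed

end

subsection \<open>Polynomial rings as records\<close>

lemma mpoly_ring_simps [simp]:
  "\<one>\<^bsub>mpoly_ring X\<^esub> = 1" "\<zero>\<^bsub>mpoly_ring X\<^esub> = 0"
  "f \<otimes>\<^bsub>mpoly_ring X\<^esub> g = f * g" "f \<oplus>\<^bsub>mpoly_ring X\<^esub> g = f + g"
  by (simp_all add: mpoly_ring_def)

lemma mpoly_ring_0: "0 \<in> carrier (mpoly_ring X)"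
  by (simp add: mpoly_ring_def)

lemma mpoly_ring_mconst: "mconst a \<in> carrier (mpoly_ring X)"
  by (simp add: mpoly_ring_def mconst_def)

lemma mpoly_ring_1: "1 \<in> carrier (mpoly_ring X)"
  using mpoly_ring_mconst[of 1] by simp

lemma mpoly_ring_mvar: "x \<in> X \<Longrightarrow> mvar x \<in> carrier (mpoly_ring X)"
  by (simp add: mpoly_ring_def mvar_def)

lemma mpoly_ring_add:
  "f \<in> carrier (mpoly_ring X) \<Longrightarrow> g \<in> carrier (mpoly_ring X) \<Longrightarrow> f + g \<in> carrier (mpoly_ring X)"
  using keys_add[of f g] by (auto simp: mpoly_ring_def)

lemma mpoly_ring_uminus: "f \<in> carrier (mpoly_ring X) \<Longrightarrow> - f \<in> carrier (mpoly_ring X)"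
  by (simp add: mpoly_ring_def in_keys_iff)

lemma mpoly_ring_mult:
  assumes "f \<in> carrier (mpoly_ring X)" "g \<in> carrier (mpoly_ring X)"
  shows "f * g \<in> carrier (mpoly_ring X)"
proof -
  have "Poly_Mapping.keys m \<subseteq> X" if m: "m \<in> Poly_Mapping.keys (f * g)" for m
  proof -
    obtain a b where "m = a + b" "a \<in> Poly_Mapping.keys f" "b \<in> Poly_Mapping.keys g"
      using m keys_mult[of f g] by blast
    then show ?thesis
      using mpoly_ring_varsD[OF assms(1)] mpoly_ring_varsD[OF assms(2)] keys_add[of a b] by blast
  qed
  then show ?thesis
    by (simp add: mpoly_ring_def)
qed

lemma cring_mpoly_ring: "cring (mpoly_ring X)"
proof (rule cringI)
  show "abelian_group (mpoly_ring X)"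
  proof (rule abelian_groupI)
    fix f assume "f \<in> carrier (mpoly_ring X)"
    then show "\<exists>g\<in>carrier (mpoly_ring X). g \<oplus>\<^bsub>mpoly_ring X\<^esub> f = \<zero>\<^bsub>mpoly_ring X\<^esub>"
      by (intro bexI[of _ "- f"]) (simp_all add: mpoly_ring_uminus)
  qed (simp_all add: mpoly_ring_add mpoly_ring_0 add_ac)
  show "comm_monoid (mpoly_ring X)"
    by (rule comm_monoidI) (simp_all add: mpoly_ring_mult mpoly_ring_1 mult_ac)
qed (simp add: algebra_simps)

interpretation mpoly_ring: cring "mpoly_ring X" for X
  by (rule cring_mpoly_ring)

lemma mpoly_ring_pow [simp]: "f [^]\<^bsub>mpoly_ring X\<^esub> (n::nat) = f ^ n"
  by (induction n) (simp_all add: mult.commute)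

lemma mpoly_ring_idealI:
  assumes "J \<subseteq> carrier (mpoly_ring X)" "0 \<in> J"
    and "\<And>f g. f \<in> J \<Longrightarrow> g \<in> J \<Longrightarrow> f + g \<in> J"
    and "\<And>f g. f \<in> carrier (mpoly_ring X) \<Longrightarrow> g \<in> J \<Longrightarrow> f * g \<in> J"
  shows "ideal J (mpoly_ring X)"
proof (rule idealI)
  show "subgroup J (add_monoid (mpoly_ring X))"
  proof (rule mpoly_ring.add.subgroupI)
    show "\<ominus>\<^bsub>mpoly_ring X\<^esub> f \<in> J" if f: "f \<in> J" for f
    proof -
      have "\<ominus>\<^bsub>mpoly_ring X\<^esub> f = (- 1) * f"
        using f assms(1) by (intro mpoly_ring.minus_equality) (auto intro: mpoly_ring_uminus)
      then show ?thesis
        using assms(4)[OF mpoly_ring_uminus[OF mpoly_ring_1] f] by simp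
    qed
  qed (use assms in auto)
  fix f g assume "f \<in> J" "g \<in> carrier (mpoly_ring X)"
  then show "g \<otimes>\<^bsub>mpoly_ring X\<^esub> f \<in> J" "f \<otimes>\<^bsub>mpoly_ring X\<^esub> g \<in> J"
    using assms(4)[of g f] by (simp_all add: mult.commute)
qed (rule mpoly_ring.ring_axioms)

lemma subring_ideal_mpoly_ring:
  assumes "ideal J (mpoly_ring X)"
  shows "subring_ideal (carrier (mpoly_ring X)) J"
proof -
  interpret ideal J "mpoly_ring X" by fact
  show ?thesis
    using a_closed I_l_closed zero_closed
    by unfold_locales
      (auto simp: mpoly_ring_1 mpoly_ring_add mpoly_ring_uminus mpoly_ring_mult)
qed

lemma zero_in_ideal_mpoly_ring: "ideal J (mpoly_ring X) \<Longrightarrow> 0 \<in> J"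
  by (rule subring_ideal.zero_J[OF subring_ideal_mpoly_ring])

lemma subring_mpoly_ring: "subring_ideal (carrier (mpoly_ring X)) {0}"
  using mpoly_ring.zeroideal[of X] by (intro subring_ideal_mpoly_ring) simp

lemma subring_ideal_UNIV: "subring_ideal UNIV {0 :: 'b::comm_ring_1}"
  by unfold_locales simp_all

lemma (in coeff_hom) ideal_eval_kernel:
  "ideal {f \<in> carrier (mpoly_ring X). mpoly_eval c g f = 0} (mpoly_ring X)"
  by (rule mpoly_ring_idealI)
    (auto simp: mpoly_ring_0 mpoly_ring_add mpoly_ring_mult eval_add eval_mult)

text \<open>Turns vanishing of \<open>Psi\<close> in the quotient ring into membership in
  \<open>q_ideal\<close>.\<close>

lemma a_r_coset_mpoly_ring_eq_iff:
  assumes "ideal J (mpoly_ring X)" "f \<in> carrier (mpoly_ring X)"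
  shows "J +>\<^bsub>mpoly_ring X\<^esub> f = J \<longleftrightarrow> f \<in> J"
proof -
  interpret ideal J "mpoly_ring X" by fact
  show ?thesis
    using a_rcos_self[of f] a_rcos_const[of f] assms(2) by auto
qed

section \<open>Unique walks, leaves below a vertex, and products along paths\<close>

section \<open>Rooted trees\<close>

context rooted_tree
begin

text \<open>Prepending the walk from the root to \<open>u\<close> gives two walks from the root to
  \<open>v\<close>; these coincide, and the common prefix cancels.\<close>

lemma awalk_unique:
  assumes "awalk u p v" "awalk u q v"
  shows "p = q"
proof -
  obtain s where s: "awalk r s u"
    using unique_walk[of u] assms(1) by (auto simp: awalk_def)
  have "awalk r (s @ p) v" "awalk r (s @ q) v"
    using s assms by (auto intro: awalk_appendI)
  moreover have "v \<in> verts T"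
    using assms(1) by (rule awalk_last_in_verts)
  ultimately have "s @ p = s @ q"
    using unique_walk[of v] by blast
  then show ?thesis
    by simp
qed

lemma tree_path_eqI: "awalk u p v \<Longrightarrow> tree_path T u v = p"
  unfolding tree_path_def by (rule the_equality) (auto intro: awalk_unique)

lemma awalk_tree_path: "u \<rightarrow>\<^sup>*\<^bsub>T\<^esub> v \<Longrightarrow> awalk u (tree_path T u v) v"
  by (auto simp: reachable_awalk tree_path_eqI)

lemma root_reachable: "v \<in> verts T \<Longrightarrow> r \<rightarrow>\<^sup>*\<^bsub>T\<^esub> v"
  using unique_walk[of v] by (auto simp: reachable_awalk)

lemma reachable_in_verts':
  assumes "u \<rightarrow>\<^sup>*\<^bsub>T\<^esub> v" shows "u \<in> verts T" "v \<in> verts T"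
  using reachable_in_verts[OF assms] by auto

lemma reachable_head:
  assumes "e \<in> out_arcs T v"
  shows "v \<rightarrow>\<^sup>*\<^bsub>T\<^esub> head T e"
  using assms by (auto simp: reachable_awalk intro!: exI[of _ "[e]"] arc_implies_awalk)

lemma reachable_head_trans:
  assumes "u \<rightarrow>\<^sup>*\<^bsub>T\<^esub> v" "e \<in> out_arcs T v"
  shows "u \<rightarrow>\<^sup>*\<^bsub>T\<^esub> head T e"
  using assms reachable_head reachable_trans by blast

lemma tree_path_self: "u \<in> verts T \<Longrightarrow> tree_path T u u = []"
  by (rule tree_path_eqI) (simp add: awalk_Nil_iff)

lemma tree_path_append:
  assumes "u \<rightarrow>\<^sup>*\<^bsub>T\<^esub> v" "v \<rightarrow>\<^sup>*\<^bsub>T\<^esub> w"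
  shows "tree_path T u w = tree_path T u v @ tree_path T v w"
  using awalk_appendI[OF assms[THEN awalk_tree_path]] by (rule tree_path_eqI)

lemma tree_path_Cons:
  assumes "e \<in> out_arcs T v" "head T e \<rightarrow>\<^sup>*\<^bsub>T\<^esub> w"
  shows "tree_path T v w = e # tree_path T (head T e) w"
  using assms by (intro tree_path_eqI) (auto simp: awalk_Cons_iff awalk_tree_path)

lemma level_reachable:
  assumes "u \<rightarrow>\<^sup>*\<^bsub>T\<^esub> v"
  shows "level T r v = level T r u + length (tree_path T u v)"
  using tree_path_append[OF root_reachable assms] assms reachable_in_verts'[OF assms]
  by (simp add: level_def)

text \<open>A way back would close a cycle, and \<open>tree_path T v v\<close> would begin with
  \<open>e\<close> instead of being empty.\<close>

lemma not_reachable_back: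
  assumes "e \<in> out_arcs T v"
  shows "\<not> head T e \<rightarrow>\<^sup>*\<^bsub>T\<^esub> v"
proof
  assume *: "head T e \<rightarrow>\<^sup>*\<^bsub>T\<^esub> v"
  then have "tree_path T v v = e # tree_path T (head T e) v"
    using assms by (intro tree_path_Cons)
  moreover have "v \<in> verts T"
    using reachable_in_verts'[OF *] by simp
  ultimately show False
    by (simp add: tree_path_self)
qed

text \<open>Induction from the leaves upwards. The number of descendants drops along an edge, since
  \<open>v\<close> is a descendant of itself but not of its child.\<close>

lemma descendant_induct [consumes 1, case_names step]:
  assumes "v \<in> verts T"
    and step: "\<And>v. v \<in> verts T \<Longrightarrow> (\<And>e. e \<in> out_arcs T v \<Longrightarrow> P (head T e)) \<Longrightarrow> P v"
  shows "P v"
  using assms(1)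
proof (induction "card {w. v \<rightarrow>\<^sup>*\<^bsub>T\<^esub> w}" arbitrary: v rule: less_induct)
  case less
  show ?case
  proof (rule step)
    fix e assume e: "e \<in> out_arcs T v"
    have "{w. head T e \<rightarrow>\<^sup>*\<^bsub>T\<^esub> w} \<subset> {w. v \<rightarrow>\<^sup>*\<^bsub>T\<^esub> w}"
      using reachable_head[OF e] not_reachable_back[OF e] less.prems
      by (auto intro: reachable_trans)
    moreover have "finite {w. v \<rightarrow>\<^sup>*\<^bsub>T\<^esub> w}"
      by (rule finite_subset[OF _ finite_verts]) (auto dest: reachable_in_verts')
    moreover have "head T e \<in> verts T"
      using reachable_head[OF e] reachable_in_verts' by blast
    ultimately show "P (head T e)"
      by (intro less.hyps psubset_card_mono)
  qed (fact less.prems)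
qed

text \<open>Depends on \<open>v\<close> alone, while \<open>leaves_through T u v\<close> also
  carries a base \<open>u\<close>; the two agree for every \<open>v\<close> below
  \<open>u\<close>.\<close>

definition leaves_below :: "'v \<Rightarrow> 'v set" where
  "leaves_below v = {l \<in> leaves T. v \<rightarrow>\<^sup>*\<^bsub>T\<^esub> l}"

lemma finite_leaves_below [simp]: "finite (leaves_below v)"
  by (rule finite_subset[OF _ finite_verts]) (auto simp: leaves_below_def leaves_def)

lemma leaves_below_leaf:
  assumes "v \<in> verts T" "out_arcs T v = {}"
  shows "leaves_below v = {v}"
proof -
  have "w = v" if "v \<rightarrow>\<^sup>*\<^bsub>T\<^esub> w" for w
    using awalk_tree_path[OF that] assms(2)
    by (cases "tree_path T v w") (auto simp: awalk_Nil_iff awalk_Cons_iff)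
  then show ?thesis
    using assms by (auto simp: leaves_below_def leaves_def)
qed

lemma leaves_below_inner:
  assumes "out_arcs T v \<noteq> {}"
  shows "leaves_below v = (\<Union>e\<in>out_arcs T v. leaves_below (head T e))"
proof
  show "leaves_below v \<subseteq> (\<Union>e\<in>out_arcs T v. leaves_below (head T e))"
  proof
    fix l assume l: "l \<in> leaves_below v"
    then have walk: "awalk v (tree_path T v l) l"
      by (simp add: leaves_below_def awalk_tree_path)
    show "l \<in> (\<Union>e\<in>out_arcs T v. leaves_below (head T e))"
    proof (cases "tree_path T v l")
      case Nil
      then show ?thesis
        using walk l assms by (auto simp: awalk_Nil_iff leaves_below_def leaves_def)
    next
      case (Cons e p)
      then show ?thesis
        using walk l
        by (auto simp: awalk_Cons_iff leaves_below_def intro!: bexI[of _ e] reachable_awalkI)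
    qed
  qed
  show "(\<Union>e\<in>out_arcs T v. leaves_below (head T e)) \<subseteq> leaves_below v"
    using reachable_head reachable_trans by (auto simp: leaves_below_def) blast
qed

text \<open>The leaf sets of different children are disjoint: a common leaf would be reached from
  \<open>v\<close> by walks with different first edges.\<close>

lemma sum_leaves_below_inner:
  fixes f :: "'v \<Rightarrow> 'b::comm_monoid_add"
  assumes "out_arcs T v \<noteq> {}"
  shows "(\<Sum>l\<in>leaves_below v. f l) = (\<Sum>e\<in>out_arcs T v. \<Sum>l\<in>leaves_below (head T e). f l)"
  unfolding leaves_below_inner[OF assms]
proof (rule sum.UNION_disjoint)
  show "\<forall>e\<in>out_arcs T v. \<forall>d\<in>out_arcs T v. e \<noteq> d \<longrightarrow>
      leaves_below (head T e) \<inter> leaves_below (head T d) = {}"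
  proof (intro ballI impI, rule ccontr)
    fix e d assume ed: "e \<in> out_arcs T v" "d \<in> out_arcs T v" "e \<noteq> d"
      and "leaves_below (head T e) \<inter> leaves_below (head T d) \<noteq> {}"
    then obtain l where "head T e \<rightarrow>\<^sup>*\<^bsub>T\<^esub> l" "head T d \<rightarrow>\<^sup>*\<^bsub>T\<^esub> l"
      by (auto simp: leaves_below_def)
    then have "e # tree_path T (head T e) l = d # tree_path T (head T d) l"
      using ed tree_path_Cons by metis
    with ed show False
      by simp
  qed
qed auto

lemma leaves_below_nonempty: "v \<in> verts T \<Longrightarrow> leaves_below v \<noteq> {}"
proof (induction v rule: descendant_induct)
  case (step v)
  then show ?case
    by (cases "out_arcs T v = {}") (auto simp: leaves_below_leaf leaves_below_inner)
qed

text \<open>Conditional probabilities multiply to a distribution on the leaves. The first edge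
  factors out of the sum over each child, the rest is one by induction, and the first factors sum to
  one.\<close>

lemma sum_prod_tree_path:
  fixes z :: "'e \<Rightarrow> 'b::comm_ring_1"
  assumes "v \<in> verts T"
    and "\<And>w. v \<rightarrow>\<^sup>*\<^bsub>T\<^esub> w \<Longrightarrow> out_arcs T w \<noteq> {} \<Longrightarrow> (\<Sum>e\<in>out_arcs T w. z e) = 1"
  shows "(\<Sum>l\<in>leaves_below v. \<Prod>e\<leftarrow>tree_path T v l. z e) = 1"
  using assms
proof (induction v rule: descendant_induct)
  case (step v)
  show ?case
  proof (cases "out_arcs T v = {}")
    case True
    then show ?thesis
      using step by (simp add: leaves_below_leaf tree_path_self)
  next
    case False
    have "(\<Sum>l\<in>leaves_below (head T e). \<Prod>d\<leftarrow>tree_path T v l. z d) = z e"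
      if e: "e \<in> out_arcs T v" for e
    proof -
      have "(\<Sum>l\<in>leaves_below (head T e). \<Prod>d\<leftarrow>tree_path T v l. z d) =
          z e * (\<Sum>l\<in>leaves_below (head T e). \<Prod>d\<leftarrow>tree_path T (head T e) l. z d)"
        unfolding sum_distrib_left using e
        by (intro sum.cong) (auto simp: leaves_below_def tree_path_Cons)
      also have "(\<Sum>l\<in>leaves_below (head T e). \<Prod>d\<leftarrow>tree_path T (head T e) l. z d) = 1"
        using step(2)[OF e] step(3) reachable_head[OF e] reachable_trans by blast
      finally show ?thesis
        by simp
    qed
    then show ?thesis
      using step(1,3) False by (simp add: sum_leaves_below_inner)
  qed
qed

lemma verts_subtree_at [simp]: "verts (subtree_at T u) = {v. u \<rightarrow>\<^sup>*\<^bsub>T\<^esub> v}"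
  by (simp add: subtree_at_def)

lemma out_arcs_subtree_at:
  assumes "u \<rightarrow>\<^sup>*\<^bsub>T\<^esub> v"
  shows "out_arcs (subtree_at T u) v = out_arcs T v"
  using assms reachable_head_trans[OF assms] by (auto simp: subtree_at_def)

lemma leaves_subtree_at: "leaves (subtree_at T u) = leaves_below u"
  using reachable_in_verts'
  by (auto simp: leaves_def leaves_below_def out_arcs_subtree_at)

text \<open>The walk from \<open>u\<close> to a leaf below \<open>v\<close> is the walk to
  \<open>v\<close> continued, so passing through \<open>v\<close> and lying below \<open>v\<close>
  amount to the same.\<close>

lemma leaves_through_eq:
  assumes "u \<rightarrow>\<^sup>*\<^bsub>T\<^esub> v"
  shows "leaves_through T u v = leaves_below v"
proof -
  have "v \<in> set (awalk_verts u (tree_path T u l)) \<longleftrightarrow> v \<rightarrow>\<^sup>*\<^bsub>T\<^esub> l" if ul: "u \<rightarrow>\<^sup>*\<^bsub>T\<^esub> l" for l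
  proof
    assume "v \<in> set (awalk_verts u (tree_path T u l))"
    then show "v \<rightarrow>\<^sup>*\<^bsub>T\<^esub> l"
      by (rule awalk_verts_reachable_to[OF awalk_tree_path[OF ul]])
  next
    assume vl: "v \<rightarrow>\<^sup>*\<^bsub>T\<^esub> l"
    have "v \<in> set (awalk_verts v (tree_path T v l))"
      by (cases "tree_path T v l")
        (use awalk_tree_path[OF vl] in \<open>auto simp: awalk_Cons_iff\<close>)
    then show "v \<in> set (awalk_verts u (tree_path T u l))"
      using set_awalk_verts_append[OF awalk_tree_path[OF assms] awalk_tree_path[OF vl]]
      by (simp add: tree_path_append[OF assms vl])
  qed
  moreover have "u \<rightarrow>\<^sup>*\<^bsub>T\<^esub> l" if "v \<rightarrow>\<^sup>*\<^bsub>T\<^esub> l" for l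
    using assms that by (rule reachable_trans)
  ultimately show ?thesis
    by (auto simp: leaves_through_def leaves_subtree_at leaves_below_def)
qed

text \<open>The walk from the root is cut after its first \<open>k\<close> edges.\<close>

lemma ancestor_at_level:
  assumes "v \<in> verts T" "k \<le> level T r v"
  obtains u where "u \<in> level_set T r k" "u \<rightarrow>\<^sup>*\<^bsub>T\<^esub> v"
proof -
  define p where "p = tree_path T r v"
  have "awalk r (take k p @ drop k p) v"
    unfolding p_def using awalk_tree_path[OF root_reachable[OF assms(1)]] by simp
  then obtain u where u: "awalk r (take k p) u" "awalk u (drop k p) v"
    unfolding awalk_append_iff by blast
  have "level T r u = k"
    using assms(2) by (simp add: level_def tree_path_eqI[OF u(1)] p_def)
  then show thesis
    using u that by (auto simp: level_set_def intro: reachable_awalkI awalk_last_in_verts)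
qed

lemma level_setD:
  assumes "u \<in> level_set T r k"
  shows "u \<in> verts T" "u \<rightarrow>\<^sup>*\<^bsub>T\<^esub> u" "u \<rightarrow>\<^sup>*\<^bsub>T\<^esub> v \<Longrightarrow> k \<le> level T r v"
  using assms level_reachable[of u v] by (auto simp: level_set_def)

text \<open>Along a walk the factors \<open>y (head e) / y (tail e)\<close> telescope; stated without division.\<close>

lemma prod_tree_path_telescope:
  assumes "subring_ideal S J" "u \<rightarrow>\<^sup>*\<^bsub>T\<^esub> v"
    and "\<And>e. e \<in> arcs T \<Longrightarrow> u \<rightarrow>\<^sup>*\<^bsub>T\<^esub> tail T e \<Longrightarrow> z e \<in> S \<and> y (tail T e) * z e - y (head T e) \<in> J"
  shows "y u * (\<Prod>e\<leftarrow>tree_path T u v. z e) - y v \<in> J"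
proof -
  interpret subring_ideal S J by fact
  have "y u * (\<Prod>e\<leftarrow>p. z e) - y v \<in> J"
    if "awalk u p v" "\<And>e. e \<in> arcs T \<Longrightarrow> u \<rightarrow>\<^sup>*\<^bsub>T\<^esub> tail T e \<Longrightarrow> z e \<in> S \<and> y (tail T e) * z e - y (head T e) \<in> J"
    for p u
    using that
  proof (induction p arbitrary: u)
    case Nil
    then show ?case
      by (simp add: awalk_Nil_iff zero_J)
  next
    case (Cons e p)
    have e: "e \<in> out_arcs T u" and walk: "awalk (head T e) p v"
      using Cons.prems(1) by (auto simp: awalk_Cons_iff)
    have reach: "u \<rightarrow>\<^sup>*\<^bsub>T\<^esub> w" if "head T e \<rightarrow>\<^sup>*\<^bsub>T\<^esub> w" for w
      using reachable_head[OF e] that by (rule reachable_trans)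
    have rest: "(\<Prod>d\<leftarrow>p. z d) \<in> S"
    proof (rule prod_list_S)
      fix d assume "d \<in> set p"
      then have "d \<in> arcs T" "tail T d \<in> set (awalk_verts (head T e) p)"
        using walk by (auto simp: set_awalk_verts awalk_def)
      then show "z d \<in> S"
        using Cons.prems(2) reach awalk_verts_reachable_from[OF walk] by blast
    qed
    have "y (head T e) * (\<Prod>d\<leftarrow>p. z d) - y v \<in> J"
      using walk Cons.prems(2) reach by (intro Cons.IH) auto
    moreover have "y u * z e - y (head T e) \<in> J"
      using Cons.prems(2)[of e] e reachable_in_verts'[OF reachable_head[OF e]] by auto
    \<comment> \<open>The relation for the first edge, multiplied by the remaining product, is added
      to the induction hypothesis; the terms with \<open>y (head T e)\<close> cancel.\<close>
    ultimately have "(\<Prod>d\<leftarrow>p. z d) * (y u * z e - y (head T e)) +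
        (y (head T e) * (\<Prod>d\<leftarrow>p. z d) - y v) \<in> J"
      using rest by (intro add_J mult_J)
    then show ?case
      by (simp add: algebra_simps)
  qed
  then show ?thesis
    using assms(2,3) awalk_tree_path by blast
qed

end

context staged_tree
begin

lemma inj_on_labels: "v \<in> verts T \<Longrightarrow> inj_on \<theta> (out_arcs T v)"
  using card_stage_labels[of v] by (intro eq_card_imp_inj_on) (auto simp: stage_labels_def)

text \<open>A common label rules out disjointness of the two label sets, which leaves
  equality.\<close>

lemma same_stageI:
  assumes "e \<in> out_arcs T v" "d \<in> out_arcs T w" "\<theta> e = \<theta> d"
  shows "same_stage T \<theta> v w"
proof -
  have "v \<in> verts T" "w \<in> verts T"
    using assms by auto
  moreover have "\<theta> e \<in> stage_labels T \<theta> v \<inter> stage_labels T \<theta> w"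
    using imageI[OF assms(1), of \<theta>] imageI[OF assms(2), of \<theta>] assms(3)
    by (simp add: stage_labels_def)
  ultimately show ?thesis
    using stage_labels_eq_or_disjoint unfolding same_stage_def by blast
qed

end

section \<open>Generated ideals under evaluation, and localization at one element\<close>

section \<open>Ring-theoretic preliminaries\<close>

context coeff_hom
begin

lemma ideal_eval_vimage:
  assumes "subring_ideal S J" "\<And>a. c a \<in> S" "\<And>x. x \<in> X \<Longrightarrow> g x \<in> S"
  shows "ideal {f \<in> carrier (mpoly_ring X). mpoly_eval c g f \<in> J} (mpoly_ring X)"
proof -
  interpret subring_ideal S J by fact
  show ?thesis
    by (rule mpoly_ring_idealI)
      (auto simp: mpoly_ring_0 mpoly_ring_add mpoly_ring_mult eval_add eval_mult zero_J add_J
        intro: mult_J eval_S[of _ X c g, OF _ assms(2,3)])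
qed

text \<open>The preimage of \<open>J\<close> under evaluation is an ideal, so it suffices to check
  generators, even when \<open>J\<close> is an ideal of the subring \<open>S\<close> only.\<close>

lemma eval_genideal:
  assumes "subring_ideal S J" "\<And>a. c a \<in> S" "\<And>x. x \<in> X \<Longrightarrow> g x \<in> S"
    and "G \<subseteq> carrier (mpoly_ring X)" "\<And>f. f \<in> G \<Longrightarrow> mpoly_eval c g f \<in> J"
    and "h \<in> genideal (mpoly_ring X) G"
  shows "mpoly_eval c g h \<in> J"
  using mpoly_ring.genideal_minimal[OF ideal_eval_vimage[of S J X g], of G] assms by blast

lemma eval_genideal_0:
  assumes "G \<subseteq> carrier (mpoly_ring X)" "\<And>f. f \<in> G \<Longrightarrow> mpoly_eval c g f = 0"
    and "h \<in> genideal (mpoly_ring X) G"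
  shows "mpoly_eval c g h = 0"
  using eval_genideal[OF subring_ideal_UNIV _ _ assms(1) _ assms(3), of g] assms(2) by simp

text \<open>The localization of \<open>I\<close> at the powers of \<open>p\<close>, inside a ring that contains the inverses
  that occur.\<close>

lemma subring_ideal_localization:
  fixes g :: "'x \<Rightarrow> 'b"
  assumes "ideal I (mpoly_ring X)" "p \<in> carrier (mpoly_ring X)"
  defines "loc \<equiv> \<lambda>M. {z. \<exists>n. \<exists>f\<in>M. mpoly_eval c g p ^ n * z = mpoly_eval c g f}"
  shows "subring_ideal (loc (carrier (mpoly_ring X))) (loc I)"
proof -
  interpret I: subring_ideal "carrier (mpoly_ring X)" I
    using assms(1) by (rule subring_ideal_mpoly_ring)
  let ?e = "mpoly_eval c g"
  have locI: "z \<in> loc M" if "f \<in> M" "?e p ^ n * z = ?e f" for z n f M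
    using that by (auto simp: loc_def)
  have add: "x + y \<in> loc M" if M: "\<And>a b. a \<in> M \<Longrightarrow> b \<in> M \<Longrightarrow> a + b \<in> M"
      "\<And>a b. a \<in> carrier (mpoly_ring X) \<Longrightarrow> b \<in> M \<Longrightarrow> a * b \<in> M"
      and xy: "x \<in> loc M" "y \<in> loc M" for x y M
  proof -
    obtain m f n h where "f \<in> M" "h \<in> M" and eqs: "?e p ^ m * x = ?e f" "?e p ^ n * y = ?e h"
      using xy by (auto simp: loc_def)
    \<comment> \<open>Addition of fractions over the common denominator
      \<open>p ^ (m + n)\<close>.\<close>
    have "?e p ^ (m + n) * (x + y) = ?e p ^ n * (?e p ^ m * x) + ?e p ^ m * (?e p ^ n * y)"
      by (simp add: power_add algebra_simps)
    also have "\<dots> = ?e (p ^ n * f + p ^ m * h)"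
      by (simp only: eqs eval_simps)
    finally show ?thesis
      using \<open>f \<in> M\<close> \<open>h \<in> M\<close> assms(2) by (intro locI) (auto intro: M I.power_S)
  qed
  have mult: "x * y \<in> loc M" if M: "\<And>a b. a \<in> carrier (mpoly_ring X) \<Longrightarrow> b \<in> M \<Longrightarrow> a * b \<in> M"
      and xy: "x \<in> loc (carrier (mpoly_ring X))" "y \<in> loc M" for x y M
  proof -
    obtain m f n h where "f \<in> carrier (mpoly_ring X)" "h \<in> M"
      and eqs: "?e p ^ m * x = ?e f" "?e p ^ n * y = ?e h"
      using xy by (auto simp: loc_def)
    have "?e p ^ (m + n) * (x * y) = (?e p ^ m * x) * (?e p ^ n * y)"
      by (simp add: power_add algebra_simps)
    also have "\<dots> = ?e (f * h)"
      by (simp only: eqs eval_simps)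
    finally show ?thesis
      using \<open>f \<in> _\<close> \<open>h \<in> M\<close> by (intro locI) (auto intro: M)
  qed
  have emb: "?e f \<in> loc M" if "f \<in> M" for f M
    using that by (intro locI[of f M 0]) auto
  show ?thesis
  proof (rule subring_ideal.intro)
    show "1 \<in> loc (carrier (mpoly_ring X))" "0 \<in> loc I"
      using emb[OF I.one_S] emb[OF I.zero_J] by simp_all
    fix x y assume x: "x \<in> loc (carrier (mpoly_ring X))"
    have "- 1 * x \<in> loc (carrier (mpoly_ring X))"
      using emb[OF I.uminus_S[OF I.one_S]] x
      by (intro mult) (auto simp: eval_uminus intro: I.mult_S)
    then show "- x \<in> loc (carrier (mpoly_ring X))"
      by simp
    show "x * y \<in> loc (carrier (mpoly_ring X))" if "y \<in> loc (carrier (mpoly_ring X))"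
      using x that by (intro mult) (auto intro: I.mult_S)
    show "x + y \<in> loc (carrier (mpoly_ring X))" if "y \<in> loc (carrier (mpoly_ring X))"
      using x that by (intro add) (auto intro: I.add_S I.mult_S)
    show "x * y \<in> loc I" if "y \<in> loc I"
      using x that by (intro mult) (auto intro: I.mult_J)
  next
    fix x y assume "x \<in> loc I" "y \<in> loc I"
    then show "x + y \<in> loc I"
      by (intro add) (auto intro: I.add_J I.mult_J)
  qed
qed

end

lemma to_fract_mpoly_eval:
  fixes g :: "'x \<Rightarrow> nat rpoly"
  shows "to_fract (mpoly_eval mconst g f) = mpoly_eval (\<lambda>a. to_fract (mconst a)) (\<lambda>x. to_fract (g x)) f"
proof -
  have power: "to_fract (a ^ n) = to_fract a ^ n" for a :: "nat rpoly" and n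
    by (induction n) simp_all
  have prod: "to_fract (\<Prod>x\<in>A. h x) = (\<Prod>x\<in>A. to_fract (h x))" for A and h :: "'x \<Rightarrow> nat rpoly"
    by (induction A rule: infinite_finite_induct) simp_all
  show ?thesis
    by (simp add: mpoly_eval_def power prod)
qed

lemma set_add_mpoly_ring_iff:
  assumes "coeff_hom c" "0 \<in> I" "0 \<in> J"
  shows "(\<forall>f\<in>I <+>\<^bsub>mpoly_ring X\<^esub> J. mpoly_eval c x f = 0) \<longleftrightarrow>
    (\<forall>f\<in>I. mpoly_eval c x f = 0) \<and> (\<forall>f\<in>J. mpoly_eval c x f = 0)"
proof -
  interpret coeff_hom c by fact
  have eq: "I <+>\<^bsub>mpoly_ring X\<^esub> J = {f + g | f g. f \<in> I \<and> g \<in> J}"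
    by (auto simp: set_add_def set_mult_def)
  have "I \<subseteq> I <+>\<^bsub>mpoly_ring X\<^esub> J" "J \<subseteq> I <+>\<^bsub>mpoly_ring X\<^esub> J"
    unfolding eq using assms(2,3) by force+
  moreover have "mpoly_eval c x h = 0"
    if "\<forall>f\<in>I. mpoly_eval c x f = 0" "\<forall>f\<in>J. mpoly_eval c x f = 0" "h \<in> I <+>\<^bsub>mpoly_ring X\<^esub> J" for h
    using that by (auto simp: eq eval_add)
  ultimately show ?thesis
    by blast
qed

lemma (in staged_tree) sum_stage:
  fixes z :: "'l \<Rightarrow> 'b::comm_monoid_add"
  assumes "v \<in> verts T"
  shows "(\<Sum>e\<in>out_arcs T v. z (\<theta> e)) = (\<Sum>l\<in>stage_labels T \<theta> v. z l)"
  using sum.reindex[OF inj_on_labels[OF assms], of z] by (simp add: stage_labels_def)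

section \<open>The coordinate ring, generators of the ideals, and the monomial map\<close>

section \<open>Coordinates of an interventional staged tree\<close>

context interventional_staged_tree
begin

abbreviation "U \<equiv> level_set T r k"
abbreviation "D \<equiv> coords T r k"
abbreviation "R \<equiv> data_ring T r k"
abbreviation "Q \<equiv> param_ring T r L k"
abbreviation "param_vars \<equiv> Inl ` U \<union> Inr ` L :: ('v + 'l) set"

lemma finite_U: "finite U"
  by (rule finite_subset[OF _ finite_verts]) (auto simp: level_set_def)

lemma coords_eq: "D = (SIGMA u:U. leaves_below u)"
  by (simp add: coords_def leaves_subtree_at)

lemma finite_D: "finite D"
  by (simp add: coords_eq finite_U)

lemma finite_L: "finite L"
  using label_surj finite_arcs by (metis finite_Un finite_imageI)

lemma coordsD:
  assumes "(u, l) \<in> D"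
  shows "u \<in> U" "u \<rightarrow>\<^sup>*\<^bsub>T\<^esub> l" "l \<in> verts T" "out_arcs T l = {}"
  using assms by (auto simp: coords_eq leaves_below_def leaves_def)

lemma coordsI:
  assumes "u \<in> U" "u \<rightarrow>\<^sup>*\<^bsub>T\<^esub> v" "l \<in> leaves_below v"
  shows "(u, l) \<in> D"
  using assms reachable_trans by (auto simp: coords_eq leaves_below_def)

lemma label_in_L:
  assumes "e \<in> out_arcs T v" "k \<le> level T r v"
  shows "\<theta> e \<in> L"
  using assms labels_below by auto

lemma label_in_L':
  assumes "u \<in> U" "e \<in> arcs T" "u \<rightarrow>\<^sup>*\<^bsub>T\<^esub> tail T e"
  shows "\<theta> e \<in> L"
  using assms by (intro label_in_L[of e "tail T e"] level_setD(3)) auto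

lemma tree_path_arcs:
  assumes "e \<in> set (tree_path T u v)" "u \<rightarrow>\<^sup>*\<^bsub>T\<^esub> v"
  shows "e \<in> arcs T" "u \<rightarrow>\<^sup>*\<^bsub>T\<^esub> tail T e"
proof -
  have walk: "awalk u (tree_path T u v) v"
    using assms(2) by (rule awalk_tree_path)
  then show "e \<in> arcs T"
    using assms(1) by (auto simp: awalk_def)
  have "tail T e \<in> set (awalk_verts u (tree_path T u v))"
    using assms(1) set_awalk_verts[OF walk] by auto
  then show "u \<rightarrow>\<^sup>*\<^bsub>T\<^esub> tail T e"
    by (rule awalk_verts_reachable_from[OF walk])
qed

lemma p_at_eq:
  assumes "u \<rightarrow>\<^sup>*\<^bsub>T\<^esub> v"
  shows "p_at T u v = (\<Sum>l\<in>leaves_below v. mvar (u, l))"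
  by (simp add: p_at_def leaves_through_eq[OF assms])

lemma p_at_inner:
  assumes "u \<rightarrow>\<^sup>*\<^bsub>T\<^esub> v" "out_arcs T v \<noteq> {}"
  shows "p_at T u v = (\<Sum>e\<in>out_arcs T v. p_at T u (head T e))"
  unfolding p_at_eq[OF assms(1)] sum_leaves_below_inner[OF assms(2)]
  using reachable_head_trans[OF assms(1)] by (intro sum.cong) (simp_all add: p_at_eq)

lemma p_at_leaf: "(u, l) \<in> D \<Longrightarrow> p_at T u l = mvar (u, l)"
  by (simp add: p_at_eq leaves_below_leaf coordsD)

lemma p_at_carrier:
  assumes "u \<in> U" "u \<rightarrow>\<^sup>*\<^bsub>T\<^esub> v"
  shows "p_at T u v \<in> carrier R"
proof -
  \<comment> \<open>Taken with the zero ideal, this supplies the closure rules of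
    \<open>carrier R\<close>.\<close>
  interpret subring_ideal "carrier R" "{0}"
    by (rule subring_mpoly_ring)
  show ?thesis
    unfolding p_at_eq[OF assms(2)] using assms by (intro sum_S mpoly_ring_mvar coordsI)
qed

text \<open>The cofactor lies in the ring, so inverting the single element
  \<open>p_prod T r k\<close> inverts every \<open>p_at T u v\<close>.\<close>

lemma p_at_factor:
  assumes "u \<in> U" "u \<rightarrow>\<^sup>*\<^bsub>T\<^esub> v"
  obtains g where "g \<in> carrier R" "p_prod T r k = p_at T u v * g"
proof -
  interpret subring_ideal "carrier R" "{0}"
    by (rule subring_mpoly_ring)
  let ?W = "\<lambda>u. {v. u \<rightarrow>\<^sup>*\<^bsub>T\<^esub> v}"
  have fin: "finite (?W u)" for u
    by (rule finite_subset[OF _ finite_verts]) (auto dest: reachable_in_verts')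
  let ?g = "(\<Prod>w\<in>?W u - {v}. p_at T u w) * (\<Prod>u'\<in>U - {u}. \<Prod>w\<in>?W u'. p_at T u' w)"
  have "p_prod T r k = p_at T u v * ?g"
    unfolding p_prod_def verts_subtree_at
    using prod.remove[OF finite_U assms(1), of "\<lambda>u. \<Prod>w\<in>?W u. p_at T u w"]
      prod.remove[OF fin, of v u "p_at T u"] assms(2) by (simp add: mult.assoc)
  moreover have "?g \<in> carrier R"
    using assms(1) by (intro mult_S prod_S p_at_carrier) auto
  ultimately show thesis
    using that by blast
qed

lemma p_prod_carrier: "p_prod T r k \<in> carrier R"
proof -
  interpret subring_ideal "carrier R" "{0}"
    by (rule subring_mpoly_ring)
  show ?thesis
    unfolding p_prod_def by (intro prod_S p_at_carrier) auto
qed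

text \<open>The stage equations over any commutative ring, so that real parameters and the
  polynomial solution \<open>eliminate\<close> can be treated alike.\<close>

definition stochastic :: "('l \<Rightarrow> 'b::comm_ring_1) \<Rightarrow> bool" where
  "stochastic z \<longleftrightarrow> (\<forall>v\<in>verts T. k \<le> level T r v \<and> out_arcs T v \<noteq> {} \<longrightarrow>
     (\<Sum>e\<in>out_arcs T v. z (\<theta> e)) = 1)"

definition invariant_gens :: "('v \<times> 'v) rpoly set" where
  "invariant_gens =
     {p_at T u1 v * p_at T u2 (head T d) - p_at T u1 (head T e) * p_at T u2 w | u1 u2 v w e d.
        u1 \<in> U \<and> u2 \<in> U \<and> u1 \<rightarrow>\<^sup>*\<^bsub>T\<^esub> v \<and> u2 \<rightarrow>\<^sup>*\<^bsub>T\<^esub> w \<and>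
        e \<in> out_arcs T v \<and> d \<in> out_arcs T w \<and> \<theta> e = \<theta> d}"

lemma invariants_ideal_eq: "invariants_ideal T r \<theta> k = genideal R invariant_gens"
proof -
  have "same_stage T \<theta> v w \<and> e \<in> out_arcs T v \<and> d \<in> out_arcs T w \<and> \<theta> e = \<theta> d \<longleftrightarrow>
      e \<in> out_arcs T v \<and> d \<in> out_arcs T w \<and> \<theta> e = \<theta> d" for v w e d
    using same_stageI by blast
  then have "invariant_gens =
     {p_at T u1 v * p_at T u2 (head T d) - p_at T u1 (head T e) * p_at T u2 w | u1 u2 v w e d.
        u1 \<in> U \<and> u2 \<in> U \<and>
        v \<in> verts (subtree_at T u1) \<and> w \<in> verts (subtree_at T u2) \<and> same_stage T \<theta> v w \<and>
        e \<in> out_arcs T v \<and> d \<in> out_arcs T w \<and> \<theta> e = \<theta> d}"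
    by (simp only: invariant_gens_def verts_subtree_at mem_Collect_eq)
  then show ?thesis
    by (simp only: invariants_ideal_def)
qed

lemma invariant_gens_carrier: "invariant_gens \<subseteq> carrier R"
proof -
  interpret subring_ideal "carrier R" "{0}"
    by (rule subring_mpoly_ring)
  show ?thesis
    unfolding invariant_gens_def
    by (clarsimp simp del: in_out_arcs_conv) (intro diff_S mult_S p_at_carrier; blast intro: reachable_head_trans)
qed

lemma ideal_invariants: "ideal (invariants_ideal T r \<theta> k) R"
  unfolding invariants_ideal_eq by (rule mpoly_ring.genideal_ideal[OF invariant_gens_carrier])

lemma invariant_in_ideal:
  assumes "u1 \<in> U" "u2 \<in> U" "u1 \<rightarrow>\<^sup>*\<^bsub>T\<^esub> v" "u2 \<rightarrow>\<^sup>*\<^bsub>T\<^esub> w"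
    and "e \<in> out_arcs T v" "d \<in> out_arcs T w" "\<theta> e = \<theta> d"
  shows "p_at T u1 v * p_at T u2 (head T d) - p_at T u1 (head T e) * p_at T u2 w
    \<in> invariants_ideal T r \<theta> k"
proof -
  have "p_at T u1 v * p_at T u2 (head T d) - p_at T u1 (head T e) * p_at T u2 w \<in> invariant_gens"
    unfolding invariant_gens_def using assms by blast
  then show ?thesis
    unfolding invariants_ideal_eq using mpoly_ring.genideal_self[OF invariant_gens_carrier] by blast
qed

definition stage_gens :: "('v + 'l) rpoly set" where
  "stage_gens = {(\<Sum>e\<in>out_arcs T v. mvar (Inr (\<theta> e))) - 1 | v.
        v \<in> verts T \<and> k \<le> level T r v \<and> out_arcs T v \<noteq> {}}"

lemma stage_gens_carrier: "stage_gens \<subseteq> carrier (mpoly_ring param_vars)"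
proof -
  interpret subring_ideal "carrier (mpoly_ring param_vars)" "{0}"
    by (rule subring_mpoly_ring)
  show ?thesis
    unfolding stage_gens_def
    by (clarsimp simp del: in_out_arcs_conv) (intro diff_S sum_S one_S mpoly_ring_mvar; blast intro: label_in_L)
qed

lemma q_ideal_eq: "q_ideal T r \<theta> L k = genideal (mpoly_ring param_vars) stage_gens"
  unfolding q_ideal_def stage_gens_def param_ring_def ..

lemma ideal_q: "ideal (q_ideal T r \<theta> L k) (mpoly_ring param_vars)"
  unfolding q_ideal_eq by (rule mpoly_ring.genideal_ideal[OF stage_gens_carrier])

lemma stage_gen_in_q:
  assumes "v \<in> verts T" "k \<le> level T r v" "out_arcs T v \<noteq> {}"
  shows "(\<Sum>e\<in>out_arcs T v. mvar (Inr (\<theta> e))) - 1 \<in> q_ideal T r \<theta> L k"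
  unfolding q_ideal_eq using assms mpoly_ring.genideal_self[OF stage_gens_carrier]
  by (auto simp: stage_gens_def)

text \<open>The generators of \<open>q_ideal\<close> are the stage equations, so an assignment
  solving them factors through the quotient ring.\<close>

lemma eval_q_ideal:
  assumes "coeff_hom c" "stochastic (\<lambda>l. g (Inr l))" "h \<in> q_ideal T r \<theta> L k"
  shows "mpoly_eval c g h = 0"
proof -
  interpret coeff_hom c by fact
  show ?thesis
    using assms(2,3) unfolding q_ideal_eq stochastic_def
    by (elim eval_genideal_0[OF stage_gens_carrier, rotated])
      (auto simp: stage_gens_def eval_simps)
qed

definition path_monom :: "'v \<times> 'v \<Rightarrow> ('v + 'l) rpoly" where
  "path_monom = (\<lambda>(u, l). mvar (Inl u) * (\<Prod>e\<leftarrow>tree_path T u l. mvar (Inr (\<theta> e))))"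

lemma path_monom_carrier:
  assumes "x \<in> D"
  shows "path_monom x \<in> carrier (mpoly_ring param_vars)"
proof -
  interpret subring_ideal "carrier (mpoly_ring param_vars)" "{0}"
    by (rule subring_mpoly_ring)
  obtain u l where x: "x = (u, l)" "u \<in> U" "u \<rightarrow>\<^sup>*\<^bsub>T\<^esub> l"
    using assms coordsD by (cases x) blast
  have "Inr (\<theta> e) \<in> param_vars" if "e \<in> set (tree_path T u l)" for e
    using label_in_L'[OF x(2) tree_path_arcs[OF that x(3)]] by blast
  then show ?thesis
    unfolding path_monom_def x(1) prod.case using x(2)
    by (intro mult_S prod_list_S mpoly_ring_mvar) auto
qed

text \<open>\<open>Psi\<close> before passing to cosets; the kernel is then described by membership
  in \<open>q_ideal\<close>.\<close>

abbreviation lift :: "('v \<times> 'v) rpoly \<Rightarrow> ('v + 'l) rpoly" where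
  "lift \<equiv> mpoly_eval mconst path_monom"

lemma lift_carrier: "f \<in> carrier R \<Longrightarrow> lift f \<in> carrier (mpoly_ring param_vars)"
  using subring_ideal.eval_S[OF subring_ideal_mpoly_ring[OF ideal_q]] mpoly_ring_mconst
    path_monom_carrier by blast

lemma ker_Psi_iff: "f \<in> ker_Psi T r \<theta> L k \<longleftrightarrow> f \<in> carrier R \<and> lift f \<in> q_ideal T r \<theta> L k"
  using a_r_coset_mpoly_ring_eq_iff[OF ideal_q lift_carrier[of f]]
  by (auto simp: ker_Psi_def a_kernel_def kernel_def FactRing_def Psi_def param_ring_def
    path_monom_def)

lemma eval_path_monom:
  assumes "coeff_hom c"
  shows "mpoly_eval c g (path_monom (u, l)) =
    g (Inl u) * (\<Prod>e\<leftarrow>tree_path T u l. g (Inr (\<theta> e)))"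
proof -
  interpret coeff_hom c by fact
  show ?thesis
    by (simp add: path_monom_def eval_simps)
qed

text \<open>All paths from \<open>u\<close> to leaves below \<open>v\<close> share the part up to
  \<open>v\<close>, which factors out; the products over the remaining parts sum to one by the stage
  equations.\<close>

lemma eval_lift_p_at:
  assumes "coeff_hom c" "stochastic (\<lambda>l. g (Inr l))" "u \<in> U" "u \<rightarrow>\<^sup>*\<^bsub>T\<^esub> v"
  shows "mpoly_eval c g (lift (p_at T u v)) =
    g (Inl u) * (\<Prod>e\<leftarrow>tree_path T u v. g (Inr (\<theta> e)))"
proof -
  interpret coeff_hom c by fact
  have v: "v \<in> verts T"
    using assms(4) reachable_in_verts' by blast
  let ?m = "\<lambda>v l. \<Prod>e\<leftarrow>tree_path T v l. g (Inr (\<theta> e))"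
  have "mpoly_eval c g (lift (p_at T u v)) = (\<Sum>l\<in>leaves_below v. g (Inl u) * ?m u l)"
    by (simp add: p_at_eq[OF assms(4)] eval_eval eval_sum eval_path_monom[OF assms(1)])
  also have "\<dots> = g (Inl u) * ?m u v * (\<Sum>l\<in>leaves_below v. ?m v l)"
    unfolding sum_distrib_left
    by (intro sum.cong) (auto simp: leaves_below_def tree_path_append[OF assms(4)] mult.assoc)
  also have "(\<Sum>l\<in>leaves_below v. ?m v l) = 1"
  proof (rule sum_prod_tree_path[OF v])
    fix w assume "v \<rightarrow>\<^sup>*\<^bsub>T\<^esub> w" "out_arcs T w \<noteq> {}"
    moreover have "k \<le> level T r w"
      using level_setD(3)[OF assms(3)] reachable_trans[OF assms(4)] \<open>v \<rightarrow>\<^sup>*\<^bsub>T\<^esub> w\<close> by blast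
    ultimately show "(\<Sum>e\<in>out_arcs T w. g (Inr (\<theta> e))) = 1"
      using assms(2) reachable_in_verts' unfolding stochastic_def by blast
  qed
  finally show ?thesis
    by simp
qed

abbreviation "K \<equiv> ker_Psi T r \<theta> L k"
abbreviation "I \<equiv> invariants_ideal T r \<theta> k"

section \<open>Positivity of real points, and the parametrization as a specialization\<close>

section \<open>Points of the model\<close>

lemma simplex_productD:
  assumes "y \<in> simplex_product T r k"
  shows "y \<in> extensional D" "(u, l) \<in> D \<Longrightarrow> 0 < y (u, l)"
    "u \<in> U \<Longrightarrow> (\<Sum>l\<in>leaves_below u. y (u, l)) = 1"
proof -
  show "y \<in> extensional D"
    using assms by (simp add: simplex_product_def)
  have y: "(\<lambda>l\<in>leaves_below u. y (u, l)) \<in> open_simplex (leaves_below u)" if "u \<in> U" for u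
    using assms that by (simp add: simplex_product_def leaves_subtree_at)
  show "0 < y (u, l)" if "(u, l) \<in> D"
    using y[of u] that by (auto simp: coords_eq open_simplex_def PiE_iff)
  show "(\<Sum>l\<in>leaves_below u. y (u, l)) = 1" if "u \<in> U"
    using y[OF that] by (simp add: open_simplex_def)
qed

lemma simplex_productI:
  assumes "y \<in> extensional D" "\<And>u l. (u, l) \<in> D \<Longrightarrow> 0 < y (u, l)"
    "\<And>u. u \<in> U \<Longrightarrow> (\<Sum>l\<in>leaves_below u. y (u, l)) = 1"
  shows "y \<in> simplex_product T r k"
  using assms by (auto simp: simplex_product_def leaves_subtree_at open_simplex_def coords_eq)

lemma simplex_nonneg:
  assumes "y \<in> simplex_product T r k"
  shows "y \<in> D \<rightarrow>\<^sub>E {0..}"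
  using simplex_productD(1,2)[OF assms] by (force simp: PiE_iff intro: less_imp_le)

lemma eval_p_at:
  "u \<rightarrow>\<^sup>*\<^bsub>T\<^esub> v \<Longrightarrow> mpoly_eval (\<lambda>a. a) y (p_at T u v) = (\<Sum>l\<in>leaves_below v. y (u, l))"
  by (simp add: p_at_eq coeff_hom_id.eval_sum)

lemma eval_p_at_pos:
  fixes y :: "'v \<times> 'v \<Rightarrow> real"
  assumes "y \<in> simplex_product T r k" "u \<in> U" "u \<rightarrow>\<^sup>*\<^bsub>T\<^esub> v"
  shows "0 < mpoly_eval (\<lambda>a. a) y (p_at T u v)"
  unfolding eval_p_at[OF assms(3)]
  using assms reachable_in_verts'[OF assms(3)] leaves_below_nonempty[of v]
  by (intro sum_pos simplex_productD(2) coordsI) auto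

lemma params_stochastic: "x \<in> params T r \<theta> L k \<Longrightarrow> stochastic x"
  by (simp add: params_def stochastic_def)

text \<open>Setting every indeterminate \<open>Inl u\<close> to one specializes the monomial map to
  the parametrization, because each subtree has total mass one.\<close>

lemma eval_model_map:
  assumes "f \<in> carrier R"
  shows "mpoly_eval (\<lambda>a. a) (model_map T r \<theta> k x) f =
    mpoly_eval (\<lambda>a. a) (case_sum (\<lambda>_. 1) x) (lift f)"
  unfolding coeff_hom_id.eval_eval using assms
  by (rule mpoly_eval_cong)
    (auto simp: model_map_def eval_path_monom[OF coeff_hom_id.coeff_hom_axioms])

lemma ker_vanishes_on_model:
  assumes "x \<in> params T r \<theta> L k" "f \<in> K"
  shows "mpoly_eval (\<lambda>a. a) (model_map T r \<theta> k x) f = 0"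
proof -
  have "mpoly_eval (\<lambda>a. a) (case_sum (\<lambda>_. 1) x) (lift f) = 0"
    using assms params_stochastic[of x]
    by (intro eval_q_ideal coeff_hom_id.coeff_hom_axioms) (auto simp: ker_Psi_iff)
  then show ?thesis
    using assms(2) by (simp add: ker_Psi_iff eval_model_map)
qed

lemma model_map_in_simplex_product:
  assumes "x \<in> params T r \<theta> L k"
  shows "model_map T r \<theta> k x \<in> simplex_product T r k"
proof (rule simplex_productI)
  show "model_map T r \<theta> k x \<in> extensional D"
    by (simp add: model_map_def)
next
  fix u l assume ul: "(u, l) \<in> D"
  have "0 < x (\<theta> e)" if "e \<in> set (tree_path T u l)" for e
    using label_in_L'[OF coordsD(1)[OF ul] tree_path_arcs[OF that coordsD(2)[OF ul]]] assms
    by (auto simp: params_def PiE_iff)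
  moreover have "(\<forall>e\<in>set p. 0 < x (\<theta> e)) \<longrightarrow> 0 < (\<Prod>e\<leftarrow>p. x (\<theta> e))" for p
    by (induction p) simp_all
  ultimately have "0 < (\<Prod>e\<leftarrow>tree_path T u l. x (\<theta> e))"
    by blast
  then show "0 < model_map T r \<theta> k x (u, l)"
    using ul by (simp add: model_map_def)
next
  fix u assume u: "u \<in> U"
  \<comment> \<open>The total mass is the value of \<open>p_at T u u\<close>, and the path from
    \<open>u\<close> to itself is empty.\<close>
  have "(\<Sum>l\<in>leaves_below u. model_map T r \<theta> k x (u, l)) =
      mpoly_eval (\<lambda>a. a) (model_map T r \<theta> k x) (p_at T u u)"
    using level_setD(2)[OF u] by (simp add: eval_p_at)
  also have "\<dots> = mpoly_eval (\<lambda>a. a) (case_sum (\<lambda>_. 1) x) (lift (p_at T u u))"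
    using u level_setD(2)[OF u] by (intro eval_model_map p_at_carrier)
  also have "\<dots> = 1"
    using params_stochastic[OF assms] u level_setD[OF u]
    by (subst eval_lift_p_at[OF coeff_hom_id.coeff_hom_axioms]) (simp_all add: tree_path_self)
  finally show "(\<Sum>l\<in>leaves_below u. model_map T r \<theta> k x (u, l)) = 1" .
qed

section \<open>The stage of a label, and existence of a parameter point\<close>

section \<open>Stages as label sets\<close>

definition edge_for :: "'l \<Rightarrow> 'e" where
  "edge_for l = (SOME e. e \<in> arcs T \<and> k \<le> level T r (tail T e) \<and> \<theta> e = l)"

definition stage_of :: "'l \<Rightarrow> 'l set" where
  "stage_of l = stage_labels T \<theta> (tail T (edge_for l))"

lemma edge_for:
  assumes "l \<in> L"
  shows "edge_for l \<in> arcs T" "k \<le> level T r (tail T (edge_for l))" "\<theta> (edge_for l) = l"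
proof -
  have "\<exists>e. e \<in> arcs T \<and> k \<le> level T r (tail T e) \<and> \<theta> e = l"
    using assms labels_below by blast
  from someI_ex[OF this]
  show "edge_for l \<in> arcs T" "k \<le> level T r (tail T (edge_for l))" "\<theta> (edge_for l) = l"
    by (auto simp: edge_for_def)
qed

text \<open>The edge \<open>e\<close> and the representative of its label share that label, so their
  tails are in the same stage and the choice in \<open>edge_for\<close> does not matter.\<close>

lemma stage_of_eq:
  assumes "e \<in> out_arcs T v" "k \<le> level T r v"
  shows "stage_of (\<theta> e) = stage_labels T \<theta> v"
proof -
  have "\<theta> e \<in> L"
    using assms by (rule label_in_L)
  from edge_for[OF this] have "same_stage T \<theta> (tail T (edge_for (\<theta> e))) v"
    using assms by (intro same_stageI[of "edge_for (\<theta> e)" _ e]) auto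
  then show ?thesis
    by (simp add: stage_of_def same_stage_def)
qed

lemma stage_labels_below:
  assumes "v \<in> verts T" "k \<le> level T r v"
  shows "finite (stage_labels T \<theta> v)" "stage_labels T \<theta> v \<subseteq> L"
    "l \<in> stage_labels T \<theta> v \<Longrightarrow> stage_of l = stage_labels T \<theta> v"
  using assms label_in_L stage_of_eq by (auto simp: stage_labels_def)

lemma stage_of:
  assumes "l \<in> L"
  shows "l \<in> stage_of l" "finite (stage_of l)" "stage_of l \<subseteq> L"
  using edge_for[OF assms] stage_labels_below[of "tail T (edge_for l)"]
  by (auto simp: stage_of_def stage_labels_def image_iff intro!: bexI[of _ "edge_for l"])

text \<open>Uniform weights on every stage give a positive point; it later certifies that
  \<open>p_prod\<close> lies outside the kernel.\<close>

lemma params_nonempty: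
  obtains x where "x \<in> params T r \<theta> L k"
proof
  show "(\<lambda>l\<in>L. 1 / real (card (stage_of l))) \<in> params T r \<theta> L k"
    unfolding params_def
  proof (intro CollectI conjI ballI impI)
    show "(\<lambda>l\<in>L. 1 / real (card (stage_of l))) \<in> L \<rightarrow>\<^sub>E {0<..}"
      using stage_of by (fastforce simp: card_gt_0_iff)
  next
    fix v assume v: "v \<in> verts T" and v': "k \<le> level T r v \<and> out_arcs T v \<noteq> {}"
    \<comment> \<open>\<open>stage_of (\<theta> e)\<close> is the label set of \<open>v\<close>,
      which has as many elements as \<open>v\<close> has outgoing edges.\<close>
    have "(\<Sum>e\<in>out_arcs T v. (\<lambda>l\<in>L. 1 / real (card (stage_of l))) (\<theta> e)) =
        (\<Sum>e\<in>out_arcs T v. 1 / real (card (stage_labels T \<theta> v)))"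
      using v' label_in_L stage_of_eq by (intro sum.cong) auto
    also have "\<dots> = 1"
      using v v' by (simp add: card_stage_labels card_gt_0_iff finite_out_arcs)
    finally show "(\<Sum>e\<in>out_arcs T v. (\<lambda>l\<in>L. 1 / real (card (stage_of l))) (\<theta> e)) = 1" .
  qed
qed

text \<open>At a point of the model every factor is a positive real, whereas all elements of the
  kernel vanish there.\<close>

lemma p_prod_notin_ker: "p_prod T r k \<notin> K"
proof
  assume p: "p_prod T r k \<in> K"
  obtain x where x: "x \<in> params T r \<theta> L k"
    using params_nonempty by blast
  let ?y = "model_map T r \<theta> k x"
  have "0 < mpoly_eval (\<lambda>a. a) ?y (p_prod T r k)"
    unfolding p_prod_def coeff_hom_id.eval_prod
    by (intro prod_pos eval_p_at_pos model_map_in_simplex_product x) auto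
  then show False
    using ker_vanishes_on_model[OF x p] by simp
qed

section \<open>Solving the stage equations, and a domain as target of the monomial map\<close>

section \<open>The kernel is prime\<close>

definition pivot :: "'l set \<Rightarrow> 'l" where
  "pivot B = (SOME l. l \<in> B)"

text \<open>One label of every stage is eliminated through the equation of that stage. The remaining
  variables are renumbered, since polynomials in variables from an arbitrary type carry no
  instance of \<^class>\<open>idom\<close>.\<close>

definition eliminate :: "'v + 'l \<Rightarrow> nat rpoly" where
  "eliminate x = (case x of
     Inl u \<Rightarrow> mvar (to_nat_on param_vars (Inl u))
   | Inr l \<Rightarrow> if l = pivot (stage_of l)
       then 1 - (\<Sum>m\<in>stage_of l - {l}. mvar (to_nat_on param_vars (Inr m)))
       else mvar (to_nat_on param_vars (Inr l)))"

text \<open>The pivot is sent to one minus the other labels of its stage, so splitting it off the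
  stage sum leaves one.\<close>

lemma stochastic_eliminate: "stochastic (\<lambda>l. eliminate (Inr l))"
  unfolding stochastic_def
proof (intro ballI impI)
  fix v assume v: "v \<in> verts T" "k \<le> level T r v \<and> out_arcs T v \<noteq> {}"
  define B where "B = stage_labels T \<theta> v"
  have B: "finite B" "\<And>l. l \<in> B \<Longrightarrow> stage_of l = B"
    using stage_labels_below v by (auto simp: B_def)
  have pivot: "pivot B \<in> B"
    unfolding pivot_def using v by (intro some_in_eq[THEN iffD2]) (simp add: B_def stage_labels_def)
  have "(\<Sum>e\<in>out_arcs T v. eliminate (Inr (\<theta> e))) = (\<Sum>l\<in>B. eliminate (Inr l))"
    unfolding B_def using v by (intro sum_stage)
  also have "\<dots> = eliminate (Inr (pivot B)) + (\<Sum>l\<in>B - {pivot B}. eliminate (Inr l))"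
    using B pivot by (intro sum.remove)
  also have "(\<Sum>l\<in>B - {pivot B}. eliminate (Inr l)) =
      (\<Sum>l\<in>B - {pivot B}. mvar (to_nat_on param_vars (Inr l)))"
    using B by (intro sum.cong) (auto simp: eliminate_def)
  also have "eliminate (Inr (pivot B)) =
      1 - (\<Sum>l\<in>B - {pivot B}. mvar (to_nat_on param_vars (Inr l)))"
    using B pivot by (simp add: eliminate_def)
  finally show "(\<Sum>e\<in>out_arcs T v. eliminate (Inr (\<theta> e))) = 1"
    by simp
qed

text \<open>Renumbering back inverts the elimination modulo \<open>q_ideal\<close>. Hence
  \<open>h\<close> is congruent to the renumbered image of \<open>h\<close>, which is zero.\<close>

lemma eliminate_kernel:
  assumes "h \<in> carrier (mpoly_ring param_vars)" "mpoly_eval mconst eliminate h = 0"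
  shows "h \<in> q_ideal T r \<theta> L k"
proof -
  interpret subring_ideal "carrier (mpoly_ring param_vars)" "q_ideal T r \<theta> L k"
    by (rule subring_ideal_mpoly_ring[OF ideal_q])
  define renumber where "renumber = mpoly_eval mconst (\<lambda>n. mvar (from_nat_into param_vars n))"
  have renumber_var: "renumber (mvar (to_nat_on param_vars x)) = mvar x" if "x \<in> param_vars" for x
    using that finite_U finite_L by (simp add: renumber_def countable_finite del: Un_iff)
  have renumber_eliminate: "mvar x - renumber (eliminate x) \<in> q_ideal T r \<theta> L k" if x: "x \<in> param_vars" for x
  proof (cases "\<exists>l. x = Inr l \<and> l = pivot (stage_of l)")
    case True
    then obtain l where l: "x = Inr l" "l = pivot (stage_of l)" "l \<in> L"
      using x by auto
    let ?v = "tail T (edge_for l)"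
    note e = edge_for[OF l(3)]
    have "renumber (eliminate x) = 1 - (\<Sum>m\<in>stage_of l - {l}. mvar (Inr m))"
    proof -
      have "renumber (eliminate x) =
          1 - (\<Sum>m\<in>stage_of l - {l}. renumber (mvar (to_nat_on param_vars (Inr m))))"
        using l by (simp add: eliminate_def renumber_def coeff_hom_mconst.eval_simps)
      also have "(\<Sum>m\<in>stage_of l - {l}. renumber (mvar (to_nat_on param_vars (Inr m)))) =
          (\<Sum>m\<in>stage_of l - {l}. mvar (Inr m))"
        using stage_of(3)[OF l(3)] by (intro sum.cong renumber_var) auto
      finally show ?thesis .
    qed
    \<comment> \<open>For a pivot the difference is the stage equation at \<open>?v\<close>, a
      generator of \<open>q_ideal\<close>.\<close>
    then have "mvar x - renumber (eliminate x) = (\<Sum>m\<in>stage_of l. mvar (Inr m)) - 1"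
      using sum.remove[OF stage_of(2,1)[OF l(3)], of "\<lambda>m. mvar (Inr m) :: ('v + 'l) rpoly"] l
      by (simp add: algebra_simps)
    also have "\<dots> = (\<Sum>e\<in>out_arcs T ?v. mvar (Inr (\<theta> e))) - 1"
      using e by (simp add: stage_of_def sum_stage[of _ "\<lambda>l. mvar (Inr l)"])
    also have "\<dots> \<in> q_ideal T r \<theta> L k"
      using e by (intro stage_gen_in_q) auto
    finally show ?thesis .
  next
    case False
    then have "eliminate x = mvar (to_nat_on param_vars x)"
      by (auto simp: eliminate_def split: sum.splits)
    then show ?thesis
      using renumber_var[OF x] zero_J by simp
  qed
  have q_carrier: "q_ideal T r \<theta> L k \<subseteq> carrier (mpoly_ring param_vars)"
    using ideal.axioms(1)[OF ideal_q] additive_subgroup.a_subset by blast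
  \<comment> \<open>It is \<open>mvar x\<close> minus an element of \<open>q_ideal\<close>, and both
    lie in the ring.\<close>
  have "renumber (eliminate x) \<in> carrier (mpoly_ring param_vars)" if "x \<in> param_vars" for x
    using diff_S[OF mpoly_ring_mvar[OF that] subsetD[OF q_carrier renumber_eliminate[OF that]]] by simp
  then have "mpoly_eval mconst mvar h - mpoly_eval mconst (\<lambda>x. renumber (eliminate x)) h
      \<in> q_ideal T r \<theta> L k"
    using assms(1) renumber_eliminate
    by (intro eval_cong_J[of h param_vars] mpoly_ring_mconst mpoly_ring_mvar)
  moreover have "mpoly_eval mconst (\<lambda>x. renumber (eliminate x)) h = renumber (mpoly_eval mconst eliminate h)"
    by (simp add: renumber_def coeff_hom_mconst.eval_eval)
  ultimately show ?thesis
    using assms(2) by (simp add: renumber_def)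
qed

abbreviation "eliminated \<equiv> \<lambda>x. mpoly_eval mconst eliminate (path_monom x)"

text \<open>Elimination kills exactly \<open>q_ideal\<close>, so the kernel is that of a
  homomorphism into the integral domain \<open>nat rpoly\<close>; primeness can be read off.\<close>

lemma ker_Psi_eq: "K = {f \<in> carrier R. mpoly_eval mconst eliminated f = 0}"
proof -
  have "lift f \<in> q_ideal T r \<theta> L k \<longleftrightarrow> mpoly_eval mconst eliminate (lift f) = 0"
    if "f \<in> carrier R" for f
    using eliminate_kernel[OF lift_carrier[OF that]]
      eval_q_ideal[OF coeff_hom_mconst.coeff_hom_axioms stochastic_eliminate] by blast
  then show ?thesis
    by (auto simp: ker_Psi_iff coeff_hom_mconst.eval_eval)
qed

lemma ideal_ker_Psi: "ideal K R"
  unfolding ker_Psi_eq by (rule coeff_hom_mconst.ideal_eval_kernel)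

lemma primeideal_ker_Psi: "primeideal K R"
proof (rule primeidealI[OF ideal_ker_Psi cring_mpoly_ring])
  show "carrier R \<noteq> K"
    using p_prod_carrier p_prod_notin_ker by blast
  show "f \<in> K \<or> g \<in> K" if "f \<in> carrier R" "g \<in> carrier R" "f \<otimes>\<^bsub>R\<^esub> g \<in> K" for f g
    using that by (simp add: ker_Psi_eq coeff_hom_mconst.eval_mult)
qed

text \<open>The path to a child is the path to its parent with one more edge. Both products of a
  generator thus map to the monomials of \<open>v\<close> and \<open>w\<close> times the common
  label, and they cancel.\<close>

lemma invariants_subset_ker: "I \<subseteq> K"
  unfolding invariants_ideal_eq
proof (rule mpoly_ring.genideal_minimal[OF ideal_ker_Psi], rule subsetI)
  fix f assume f: "f \<in> invariant_gens"
  then obtain u1 u2 v w e d where uv: "u1 \<in> U" "u2 \<in> U" "u1 \<rightarrow>\<^sup>*\<^bsub>T\<^esub> v" "u2 \<rightarrow>\<^sup>*\<^bsub>T\<^esub> w"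
    and ed: "e \<in> out_arcs T v" "d \<in> out_arcs T w" "\<theta> e = \<theta> d"
    and f_eq: "f = p_at T u1 v * p_at T u2 (head T d) - p_at T u1 (head T e) * p_at T u2 w"
    unfolding invariant_gens_def by blast
  have path: "tree_path T u (head T e) = tree_path T u v @ [e]"
    if "u \<rightarrow>\<^sup>*\<^bsub>T\<^esub> v" "e \<in> out_arcs T v" for u v e
    using tree_path_append[OF that(1) reachable_head[OF that(2)]] tree_path_Cons[OF that(2)]
      reachable_in_verts'[OF reachable_head[OF that(2)]] by (simp add: tree_path_self)
  note ev = eval_lift_p_at[OF coeff_hom_mconst.coeff_hom_axioms stochastic_eliminate]
  have "mpoly_eval mconst eliminate (lift f) = 0"
    unfolding f_eq coeff_hom_mconst.eval_simps
    by (simp add: ev uv ed reachable_head_trans[OF uv(3) ed(1)] reachable_head_trans[OF uv(4) ed(2)]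
        path[OF uv(3) ed(1)] path[OF uv(4) ed(2)] algebra_simps)
  then show "f \<in> K"
    using f invariant_gens_carrier by (auto simp: ker_Psi_eq coeff_hom_mconst.eval_eval)
qed

section \<open>Inverting the monomial map over a localization, and minimality of the prime\<close>

section \<open>The kernel as a saturation\<close>

text \<open>Embedding the coordinate ring in a fraction field replaces the construction of a
  localization; the variables are numbered again to obtain an integral domain.\<close>

abbreviation emb_var :: "'v \<times> 'v \<Rightarrow> nat rpoly fract" where
  "emb_var x \<equiv> to_fract (mvar (to_nat_on D x))"

definition emb :: "('v \<times> 'v) rpoly \<Rightarrow> nat rpoly fract" where
  "emb = mpoly_eval (\<lambda>a. to_fract (mconst a)) emb_var"

lemmas emb_simps = coeff_hom_fract.eval_simps[where g = emb_var, folded emb_def]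

text \<open>Passing to fractions loses nothing, and \<open>from_nat_into D\<close> undoes the
  numbering of the finite set \<open>D\<close>.\<close>

lemma emb_inj:
  assumes "f \<in> carrier R" "g \<in> carrier R" "emb f = emb g"
  shows "f = g"
proof -
  let ?\<iota> = "\<lambda>x. mvar (to_nat_on D x) :: nat rpoly" and ?\<kappa> = "\<lambda>n. mvar (from_nat_into D n)"
  have "mpoly_eval mconst ?\<iota> f = mpoly_eval mconst ?\<iota> g"
    using assms(3) by (simp add: emb_def to_fract_mpoly_eval[symmetric])
  then have "mpoly_eval mconst (\<lambda>x. mvar (from_nat_into D (to_nat_on D x))) f =
      mpoly_eval mconst (\<lambda>x. mvar (from_nat_into D (to_nat_on D x))) g"
    using coeff_hom_mconst.eval_eval[of ?\<kappa> ?\<iota> f] coeff_hom_mconst.eval_eval[of ?\<kappa> ?\<iota> g] by simp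
  moreover have "mpoly_eval mconst (\<lambda>x. mvar (from_nat_into D (to_nat_on D x))) h = h"
    if "h \<in> carrier R" for h
  proof -
    have "mpoly_eval mconst (\<lambda>x. mvar (from_nat_into D (to_nat_on D x))) h = mpoly_eval mconst mvar h"
      using that by (rule mpoly_eval_cong) (simp add: countable_finite finite_D)
    then show ?thesis
      by simp
  qed
  ultimately show ?thesis
    using assms(1,2) by simp
qed

text \<open>A vanishing factor would make \<open>p_prod\<close> zero and put it into the
  kernel.\<close>

lemma emb_p_at_nonzero:
  assumes "u \<in> U" "u \<rightarrow>\<^sup>*\<^bsub>T\<^esub> v"
  shows "emb (p_at T u v) \<noteq> 0"
proof
  assume "emb (p_at T u v) = 0"
  then have "p_at T u v = 0"
    using assms by (intro emb_inj p_at_carrier mpoly_ring_0) (simp_all add: emb_def)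
  moreover obtain g where "p_prod T r k = p_at T u v * g"
    using p_at_factor[OF assms] by blast
  ultimately show False
    using p_prod_notin_ker zero_in_ideal_mpoly_ring[OF ideal_ker_Psi] by simp
qed

definition localized :: "('v \<times> 'v) rpoly set \<Rightarrow> nat rpoly fract set" where
  "localized M = {z. \<exists>n. \<exists>f\<in>M. emb (p_prod T r k) ^ n * z = emb f}"

lemma subring_ideal_localized: "subring_ideal (localized (carrier R)) (localized I)"
  unfolding localized_def emb_def
  by (rule coeff_hom_fract.subring_ideal_localization[OF ideal_invariants p_prod_carrier])

lemma I_mult: "f \<in> carrier R \<Longrightarrow> g \<in> I \<Longrightarrow> f * g \<in> I"
  using ideal.I_l_closed[OF ideal_invariants, of g f] by simp

text \<open>Multiplying by the cofactor turns the factor \<open>p_at T u v\<close> into one more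
  power of \<open>p_prod\<close>, which the localization absorbs. So such factors can be
  cancelled.\<close>

lemma localizedI_mult_p_at:
  assumes "u \<in> U" "u \<rightarrow>\<^sup>*\<^bsub>T\<^esub> v" "emb (p_at T u v) * z \<in> localized M"
    and "\<And>f g. f \<in> carrier R \<Longrightarrow> g \<in> M \<Longrightarrow> f * g \<in> M"
  shows "z \<in> localized M"
proof -
  obtain g where g: "g \<in> carrier R" "p_prod T r k = p_at T u v * g"
    using p_at_factor[OF assms(1,2)] by blast
  obtain n f where f: "f \<in> M" "emb (p_prod T r k) ^ n * (emb (p_at T u v) * z) = emb f"
    using assms(3) by (auto simp: localized_def)
  have "emb (p_prod T r k) ^ Suc n * z = emb (p_prod T r k) ^ n * (emb (p_prod T r k) * z)"
    by (simp add: mult_ac)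
  also have "emb (p_prod T r k) * z = emb g * (emb (p_at T u v) * z)"
    by (simp add: g(2) emb_simps mult_ac)
  also have "emb (p_prod T r k) ^ n * (emb g * (emb (p_at T u v) * z)) =
      emb g * (emb (p_prod T r k) ^ n * (emb (p_at T u v) * z))"
    by (rule mult.left_commute)
  also have "\<dots> = emb (g * f)"
    by (simp add: f(2) emb_simps)
  finally show ?thesis
    unfolding localized_def using assms(4)[OF g(1) f(1)] by blast
qed

lemma localizedI: "f \<in> M \<Longrightarrow> emb f \<in> localized M"
  unfolding localized_def by (auto intro!: exI[of _ 0])

definition base_of :: "'l \<Rightarrow> 'v" where
  "base_of l = (SOME u. u \<in> U \<and> u \<rightarrow>\<^sup>*\<^bsub>T\<^esub> tail T (edge_for l))"

lemma base_of:
  assumes "l \<in> L"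
  shows "base_of l \<in> U" "base_of l \<rightarrow>\<^sup>*\<^bsub>T\<^esub> tail T (edge_for l)"
    "base_of l \<rightarrow>\<^sup>*\<^bsub>T\<^esub> head T (edge_for l)"
proof -
  have "\<exists>u. u \<in> U \<and> u \<rightarrow>\<^sup>*\<^bsub>T\<^esub> tail T (edge_for l)"
    using edge_for[OF assms] by (metis ancestor_at_level tail_in_verts)
  from someI_ex[OF this]
  show *: "base_of l \<in> U" "base_of l \<rightarrow>\<^sup>*\<^bsub>T\<^esub> tail T (edge_for l)"
    by (auto simp: base_of_def)
  show "base_of l \<rightarrow>\<^sup>*\<^bsub>T\<^esub> head T (edge_for l)"
    using edge_for(1)[OF assms] by (intro reachable_head_trans[OF *(2)]) simp
qed

text \<open>The conditional probability along the representative edge of a label. The map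
  \<open>\<epsilon>\<close> is \<open>emb\<close> for the ideals and evaluation at a real point for
  the model.\<close>

definition quotient_param :: "(('v \<times> 'v) rpoly \<Rightarrow> 'b::field) \<Rightarrow> 'l \<Rightarrow> 'b" where
  "quotient_param \<epsilon> l = \<epsilon> (p_at T (base_of l) (head T (edge_for l))) /
     \<epsilon> (p_at T (base_of l) (tail T (edge_for l)))"

lemma quotient_param_mult:
  assumes "l \<in> L"
  shows "emb (p_at T (base_of l) (tail T (edge_for l))) * quotient_param emb l =
    emb (p_at T (base_of l) (head T (edge_for l)))"
  using emb_p_at_nonzero[OF base_of(1,2)[OF assms]] by (simp add: quotient_param_def)

lemma quotient_param_in_localized:
  assumes "l \<in> L"
  shows "quotient_param emb l \<in> localized (carrier R)"
proof (rule localizedI_mult_p_at)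
  show "base_of l \<in> U" "base_of l \<rightarrow>\<^sup>*\<^bsub>T\<^esub> tail T (edge_for l)"
    using base_of[OF assms] by simp_all
  show "emb (p_at T (base_of l) (tail T (edge_for l))) * quotient_param emb l
      \<in> localized (carrier R)"
    unfolding quotient_param_mult[OF assms]
    using base_of[OF assms] by (intro localizedI p_at_carrier)
qed (rule mpoly_ring_mult)

text \<open>Clearing the denominator yields the invariant that pairs \<open>e\<close> with the
  representative edge of its label; the denominator is then cancelled.\<close>

lemma quotient_param_mod:
  assumes "u \<in> U" "e \<in> arcs T" "u \<rightarrow>\<^sup>*\<^bsub>T\<^esub> tail T e"
  shows "emb (p_at T u (tail T e)) * quotient_param emb (\<theta> e) - emb (p_at T u (head T e))
    \<in> localized I"
proof -
  have l: "\<theta> e \<in> L"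
    using assms by (rule label_in_L')
  note base = base_of[OF l] and edge = edge_for[OF l]
  let ?w = "base_of (\<theta> e)" and ?d = "edge_for (\<theta> e)"
  have "emb (p_at T ?w (tail T ?d)) *
      (emb (p_at T u (tail T e)) * quotient_param emb (\<theta> e) - emb (p_at T u (head T e))) =
      emb (p_at T u (tail T e)) * (emb (p_at T ?w (tail T ?d)) * quotient_param emb (\<theta> e)) -
      emb (p_at T u (head T e)) * emb (p_at T ?w (tail T ?d))"
    by (simp only: right_diff_distrib mult_ac)
  also have "\<dots> =
      emb (p_at T u (tail T e) * p_at T ?w (head T ?d) - p_at T u (head T e) * p_at T ?w (tail T ?d))"
    by (simp only: quotient_param_mult[OF l] emb_simps)
  also have "\<dots> \<in> localized I"
  proof (intro localizedI invariant_in_ideal)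
    show "e \<in> out_arcs T (tail T e)" "?d \<in> out_arcs T (tail T ?d)" "\<theta> e = \<theta> ?d"
      using assms edge by simp_all
  qed (use assms base in simp_all)
  finally show ?thesis
    by (rule localizedI_mult_p_at[OF base(1,2) _ I_mult])
qed

lemma ker_Psi_subset_saturation: "K \<subseteq> saturation R I (p_prod T r k)"
proof
  fix f assume f: "f \<in> K"
  interpret subring_ideal "localized (carrier R)" "localized I"
    by (rule subring_ideal_localized)
  let ?c = "\<lambda>a. to_fract (mconst a) :: nat rpoly fract"
  define h :: "'v + 'l \<Rightarrow> nat rpoly fract"
    where "h = case_sum (\<lambda>u. emb (p_at T u u)) (quotient_param emb)"
  have const: "?c a \<in> localized (carrier R)" for a
    using localizedI[OF mpoly_ring_mconst, of a] by (simp add: emb_def)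
  have h_S: "h x \<in> localized (carrier R)" if "x \<in> param_vars" for x
    using that
    by (auto simp: h_def intro!: localizedI p_at_carrier level_setD(2) quotient_param_in_localized)
  \<comment> \<open>After multiplication by \<open>p_at T u v\<close>, which is the sum over the
    children, a stage equation becomes a sum of the edge relations
    \<open>quotient_param_mod\<close>.\<close>
  have "mpoly_eval ?c h g \<in> localized I" if gen: "g \<in> stage_gens" for g
  proof -
    obtain v where g: "g = (\<Sum>e\<in>out_arcs T v. mvar (Inr (\<theta> e))) - 1"
      and v: "v \<in> verts T" "k \<le> level T r v" "out_arcs T v \<noteq> {}"
      using gen unfolding stage_gens_def by blast
    obtain u where u: "u \<in> U" "u \<rightarrow>\<^sup>*\<^bsub>T\<^esub> v"
      using v ancestor_at_level by blast
    have "emb (p_at T u v) * mpoly_eval ?c h g =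
        (\<Sum>e\<in>out_arcs T v. emb (p_at T u v) * quotient_param emb (\<theta> e)) - emb (p_at T u v)"
      by (simp add: g h_def coeff_hom_fract.eval_simps sum_distrib_left right_diff_distrib)
    also have "\<dots> = (\<Sum>e\<in>out_arcs T v.
        emb (p_at T u v) * quotient_param emb (\<theta> e) - emb (p_at T u (head T e)))"
      by (subst (2) p_at_inner[OF u(2) v(3)]) (simp only: emb_simps sum_subtractf)
    also have "\<dots> \<in> localized I"
      using u quotient_param_mod by (intro sum_J) auto
    finally show ?thesis
      by (rule localizedI_mult_p_at[OF u _ I_mult])
  qed
  then have "mpoly_eval ?c h (lift f) \<in> localized I"
    using f coeff_hom_fract.eval_genideal[OF subring_ideal_localized const h_S stage_gens_carrier]
    by (simp add: ker_Psi_iff q_ideal_eq)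
  \<comment> \<open>Substituting \<open>h\<close> after \<open>lift\<close> agrees with
    \<open>emb\<close> modulo the localized invariants; only variables need checking.\<close>
  moreover have "mpoly_eval ?c h (lift f) - emb f \<in> localized I"
    unfolding coeff_hom_fract.eval_eval emb_def
  proof (rule eval_cong_J[OF _ const])
    show fR: "f \<in> carrier R"
      using f by (simp add: ker_Psi_iff)
    fix x assume x: "x \<in> D"
    show "mpoly_eval ?c h (path_monom x) \<in> localized (carrier R)"
      using path_monom_carrier[OF x] const h_S by (rule eval_S)
    show "emb_var x \<in> localized (carrier R)"
      using localizedI[OF mpoly_ring_mvar[OF x]] by (simp add: emb_def)
    obtain u l where ul: "x = (u, l)" "(u, l) \<in> D"
      using x by (cases x) auto
    \<comment> \<open>The quotients telescope down to the leaf \<open>l\<close>, where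
      \<open>p_at T u l\<close> is the variable itself.\<close>
    have "emb (p_at T u u) * (\<Prod>e\<leftarrow>tree_path T u l. quotient_param emb (\<theta> e)) - emb (p_at T u l)
        \<in> localized I"
      using coordsD(1,2)[OF ul(2)]
      by (intro prod_tree_path_telescope[OF subring_ideal_localized,
            where y = "\<lambda>w. emb (p_at T u w)"] conjI
          quotient_param_in_localized quotient_param_mod label_in_L')
    then show "mpoly_eval ?c h (path_monom x) - emb_var x \<in> localized I"
      by (simp add: ul(1) eval_path_monom[OF coeff_hom_fract.coeff_hom_axioms] h_def
          p_at_leaf[OF ul(2)] emb_def)
  qed
  ultimately have "emb f \<in> localized I"
    using diff_J by fastforce
  then obtain n g where g: "g \<in> I" "emb (p_prod T r k ^ n * f) = emb g"
    by (auto simp: localized_def emb_simps)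
  interpret C: subring_ideal "carrier R" I
    by (rule subring_ideal_mpoly_ring[OF ideal_invariants])
  have fR: "f \<in> carrier R"
    using f by (simp add: ker_Psi_iff)
  have "g \<in> carrier R"
    using g(1) invariants_subset_ker by (auto simp: ker_Psi_iff)
  \<comment> \<open>Injectivity of \<open>emb\<close> brings the identity with cleared denominators
    back to \<open>R\<close>.\<close>
  then have "p_prod T r k ^ n * f = g"
    using g fR p_prod_carrier by (intro emb_inj C.mult_S C.power_S) auto
  then show "f \<in> saturation R I (p_prod T r k)"
    using fR g(1) by (auto simp: saturation_def)
qed

lemma saturation_eq_ker_Psi: "saturation R I (p_prod T r k) = K"
proof
  show "saturation R I (p_prod T r k) \<subseteq> K"
  proof
    fix f assume "f \<in> saturation R I (p_prod T r k)"
    then obtain n where f: "f \<in> carrier R" "p_prod T r k ^ n * f \<in> I"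
      by (auto simp: saturation_def)
    \<comment> \<open>In the integral domain the nonzero image of \<open>p_prod\<close>, and so each
      of its powers, cancels.\<close>
    have "mpoly_eval mconst eliminated (p_prod T r k) \<noteq> 0"
      using p_prod_notin_ker p_prod_carrier by (simp add: ker_Psi_eq)
    moreover have "mpoly_eval mconst eliminated (p_prod T r k ^ n * f) = 0"
      using f(2) invariants_subset_ker by (auto simp: ker_Psi_eq)
    ultimately show "f \<in> K"
      using f(1) by (simp add: ker_Psi_eq coeff_hom_mconst.eval_mult coeff_hom_mconst.eval_power)
  qed
qed (rule ker_Psi_subset_saturation)

lemma ker_Psi_minimal_prime: "minimal_prime_over R I K"
  unfolding minimal_prime_over_def
proof (intro conjI allI impI primeideal_ker_Psi invariants_subset_ker)
  fix P assume P: "primeideal P R \<and> I \<subseteq> P \<and> P \<subseteq> K"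
  interpret primeideal P R
    using P by blast
  \<comment> \<open>\<open>P\<close> is proper and prime, so a power in \<open>P\<close> would put
    \<open>p_prod\<close> into \<open>P\<close>, hence into \<open>K\<close>.\<close>
  have notin: "p_prod T r k ^ n \<notin> P" for n
  proof (induction n)
    case 0
    show ?case
      using one_imp_carrier I_notcarr by auto
  next
    case (Suc n)
    interpret C: subring_ideal "carrier R" P
      by (rule subring_ideal_mpoly_ring) (rule is_ideal)
    show ?case
      using I_prime[of "p_prod T r k" "p_prod T r k ^ n"] Suc P p_prod_notin_ker p_prod_carrier
        C.power_S[OF p_prod_carrier] by auto
  qed
  interpret C: subring_ideal "carrier R" P
    by (rule subring_ideal_mpoly_ring) (rule is_ideal)
  \<comment> \<open>Some \<open>p_prod ^ n * f\<close> lies in \<open>I\<close> and so in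
    \<open>P\<close>, and the first factor is outside \<open>P\<close>.\<close>
  have "f \<in> P" if "f \<in> K" for f
  proof -
    have "f \<in> saturation R I (p_prod T r k)"
      using that by (simp only: saturation_eq_ker_Psi)
    then obtain n where "f \<in> carrier R" "p_prod T r k ^ n * f \<in> I"
      by (auto simp: saturation_def)
    then show ?thesis
      using I_prime[of "p_prod T r k ^ n" f] P notin[of n] C.power_S[OF p_prod_carrier] by auto
  qed
  then show "P = K"
    using P by blast
qed

section \<open>Recovering parameters from positive zeros of the invariants\<close>

section \<open>Nonnegative points\<close>

lemma model_param_exists:
  assumes y: "y \<in> simplex_product T r k"
    and vanish: "\<And>f. f \<in> I \<Longrightarrow> mpoly_eval (\<lambda>a. a) y f = 0"
  shows "y \<in> model T r \<theta> L k"
proof -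
  let ?\<epsilon> = "mpoly_eval (\<lambda>a. a) y"
  define x where "x = restrict (quotient_param ?\<epsilon>) L"
  note pos = eval_p_at_pos[OF y]
  \<comment> \<open>The vanishing invariant for \<open>e\<close> and the representative edge of its
    label is divided by a positive denominator.\<close>
  have step: "?\<epsilon> (p_at T u v) * x (\<theta> e) = ?\<epsilon> (p_at T u (head T e))"
    if u: "u \<in> U" "u \<rightarrow>\<^sup>*\<^bsub>T\<^esub> v" and e: "e \<in> out_arcs T v" for u v e
  proof -
    have l: "\<theta> e \<in> L"
      using u e by (intro label_in_L[OF e] level_setD(3))
    note base = base_of[OF l] and edge = edge_for[OF l]
    let ?w = "base_of (\<theta> e)" and ?d = "edge_for (\<theta> e)"
    have "?\<epsilon> (p_at T u v * p_at T ?w (head T ?d) - p_at T u (head T e) * p_at T ?w (tail T ?d)) = 0"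
      using u e base edge by (intro vanish invariant_in_ideal) auto
    then show ?thesis
      using pos[OF base(1,2)] l
      by (simp add: x_def quotient_param_def coeff_hom_id.eval_simps field_simps)
  qed
  have "x \<in> params T r \<theta> L k"
    unfolding params_def
  proof (intro CollectI conjI ballI impI)
    show "x \<in> L \<rightarrow>\<^sub>E {0<..}"
      using pos base_of by (auto simp: x_def quotient_param_def)
  next
    fix v assume v: "v \<in> verts T" "k \<le> level T r v \<and> out_arcs T v \<noteq> {}"
    then obtain u where u: "u \<in> U" "u \<rightarrow>\<^sup>*\<^bsub>T\<^esub> v"
      using ancestor_at_level by blast
    have "?\<epsilon> (p_at T u v) * (\<Sum>e\<in>out_arcs T v. x (\<theta> e)) =
        (\<Sum>e\<in>out_arcs T v. ?\<epsilon> (p_at T u (head T e)))"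
      unfolding sum_distrib_left using u step by (intro sum.cong) auto
    also have "\<dots> = ?\<epsilon> (p_at T u v)"
      using v by (simp add: p_at_inner[OF u(2)] coeff_hom_id.eval_sum)
    finally show "(\<Sum>e\<in>out_arcs T v. x (\<theta> e)) = 1"
      using pos[OF u] by simp
  qed
  moreover have "model_map T r \<theta> k x = y"
  proof (rule extensionalityI)
    show "model_map T r \<theta> k x \<in> extensional D" "y \<in> extensional D"
      using simplex_productD(1)[OF y] by (simp_all add: model_map_def)
    fix a assume a: "a \<in> D"
    obtain u l where ul: "a = (u, l)" "(u, l) \<in> D"
      using a by (cases a) auto
    \<comment> \<open>For the zero ideal the telescoping congruence is an equation; it starts at
      total mass one and ends at the coordinate of \<open>l\<close>.\<close>
    have "?\<epsilon> (p_at T u u) * (\<Prod>e\<leftarrow>tree_path T u l. x (\<theta> e)) - ?\<epsilon> (p_at T u l) \<in> {0}"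
      using coordsD(1,2)[OF ul(2)] step
      by (intro prod_tree_path_telescope[OF subring_ideal_UNIV,
            where y = "\<lambda>w. ?\<epsilon> (p_at T u w)"]) auto
    moreover have "?\<epsilon> (p_at T u u) = 1"
      using simplex_productD(3)[OF y] coordsD(1)[OF ul(2)] by (simp add: eval_p_at level_setD(2))
    moreover have "?\<epsilon> (p_at T u l) = y (u, l)"
      by (simp add: p_at_leaf[OF ul(2)])
    ultimately show "model_map T r \<theta> k x a = y a"
      using ul by (simp add: model_map_def)
  qed
  ultimately show ?thesis
    unfolding model_def by blast
qed

lemma sum_to_one_vanishes:
  assumes "y \<in> simplex_product T r k" "f \<in> sum_to_one_ideal T r k"
  shows "mpoly_eval (\<lambda>a. a) y f = 0"
proof (rule coeff_hom_id.eval_genideal_0)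
  interpret subring_ideal "carrier R" "{0}"
    by (rule subring_mpoly_ring)
  show "{p_at T u u - 1 | u. u \<in> U} \<subseteq> carrier R"
    by (auto intro!: diff_S one_S p_at_carrier level_setD(2))
  show "f \<in> genideal R {p_at T u u - 1 | u. u \<in> U}"
    using assms(2) by (simp add: sum_to_one_ideal_def)
  show "mpoly_eval (\<lambda>a. a) y g = 0" if "g \<in> {p_at T u u - 1 | u. u \<in> U}" for g
    using that simplex_productD(3)[OF assms(1)]
    by (auto simp: coeff_hom_id.eval_simps eval_p_at level_setD(2))
qed

text \<open>Points of the simplex product have nonnegative coordinates and are zeros of
  \<open>sum_to_one_ideal\<close>, so what remains is vanishing on \<open>J\<close>.\<close>

lemma nonneg_variety_simplex:
  assumes "0 \<in> J"
  shows "nonneg_variety D (J <+>\<^bsub>R\<^esub> sum_to_one_ideal T r k) \<inter> simplex_product T r k =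
    {y \<in> simplex_product T r k. \<forall>f\<in>J. mpoly_eval (\<lambda>a. a) y f = 0}"
proof -
  interpret subring_ideal "carrier R" "{0}"
    by (rule subring_mpoly_ring)
  have "{p_at T u u - 1 | u. u \<in> U} \<subseteq> carrier R"
    by (auto intro!: diff_S one_S p_at_carrier level_setD(2))
  then have "ideal (sum_to_one_ideal T r k) R"
    unfolding sum_to_one_ideal_def by (rule mpoly_ring.genideal_ideal)
  then have "0 \<in> sum_to_one_ideal T r k"
    by (rule zero_in_ideal_mpoly_ring)
  note vanish_iff = set_add_mpoly_ring_iff[OF coeff_hom_id.coeff_hom_axioms assms this]
  show ?thesis
    unfolding nonneg_variety_def vanish_iff
    using simplex_nonneg sum_to_one_vanishes by auto
qed

text \<open>A cycle of inclusions: the model lies in the zeros of \<open>K\<close>, these in the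
  zeros of the smaller ideal \<open>I\<close>, and these in the model.\<close>

lemma nonneg_points:
  "{y \<in> simplex_product T r k. \<forall>f\<in>I. mpoly_eval (\<lambda>a. a) y f = 0} = model T r \<theta> L k"
  "{y \<in> simplex_product T r k. \<forall>f\<in>K. mpoly_eval (\<lambda>a. a) y f = 0} = model T r \<theta> L k"
proof -
  have "model T r \<theta> L k \<subseteq> {y \<in> simplex_product T r k. \<forall>f\<in>K. mpoly_eval (\<lambda>a. a) y f = 0}"
    using ker_vanishes_on_model model_map_in_simplex_product by (auto simp: model_def)
  moreover have "{y \<in> simplex_product T r k. \<forall>f\<in>I. mpoly_eval (\<lambda>a. a) y f = 0} \<subseteq> model T r \<theta> L k"
    using model_param_exists by blast
  ultimately show
    "{y \<in> simplex_product T r k. \<forall>f\<in>I. mpoly_eval (\<lambda>a. a) y f = 0} = model T r \<theta> L k"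
    "{y \<in> simplex_product T r k. \<forall>f\<in>K. mpoly_eval (\<lambda>a. a) y f = 0} = model T r \<theta> L k"
    using invariants_subset_ker by blast+
qed

lemma zero_in_ideals: "0 \<in> I" "0 \<in> K"
  by (rule zero_in_ideal_mpoly_ring[OF ideal_invariants] zero_in_ideal_mpoly_ring[OF ideal_ker_Psi])+

end

theorem theorem4p3:
  fixes T :: "('v, 'e) pre_digraph" and r :: 'v and \<theta> :: "'e \<Rightarrow> 'l"
    and TL :: "('w, 'f) pre_digraph" and rL :: 'w
    and A L :: "'l set" and k :: nat
    and idx :: "'l \<Rightarrow> 'w set"
    and \<phi> :: "'v \<Rightarrow> ('v, 'e, 'w, 'f) digraph_isomorphism"
  assumes "interventional_staged_tree T r \<theta> TL rL A L k idx \<phi>"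
  defines "R \<equiv> data_ring T r k"
    and "I \<equiv> invariants_ideal T r \<theta> k"
    and "K \<equiv> ker_Psi T r \<theta> L k"
    and "P \<equiv> sum_to_one_ideal T r k"
  shows "(I \<subseteq> K \<and> saturation R I (p_prod T r k) = K)
    \<and> minimal_prime_over R I K
    \<and> (nonneg_variety (coords T r k) (I <+>\<^bsub>R\<^esub> P) \<inter> simplex_product T r k
        = nonneg_variety (coords T r k) (K <+>\<^bsub>R\<^esub> P) \<inter> simplex_product T r k
      \<and> nonneg_variety (coords T r k) (K <+>\<^bsub>R\<^esub> P) \<inter> simplex_product T r k = model T r \<theta> L k)"
proof -
  interpret tree: interventional_staged_tree T r \<theta> TL rL A L k idx \<phi>
    by fact
  show ?thesis
    unfolding R_def I_def K_def P_def
      tree.nonneg_variety_simplex[OF tree.zero_in_ideals(1)]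
      tree.nonneg_variety_simplex[OF tree.zero_in_ideals(2)] tree.nonneg_points
    by (intro conjI refl tree.invariants_subset_ker tree.saturation_eq_ker_Psi
        tree.ker_Psi_minimal_prime)
qed

end
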